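(* For every $n\in\mathbb{N}$, the map $\Phi:\mathfrak{R}_n\to\mathrm{SYT}^{\equiv}_{\le 3}(n)$ is a bijection.
   Context: Permutations. For a permutation $\pi=\pi_1\cdots\pi_n$ of $[n]=\{1,\dots,n\}$, an entry $\pi_i$ is a left-to-right (LR) maximum if $\pi_i>\pi_j$ for all $j<i$; $\mathrm{LR}(\pi)$ is the set of LR maxima (as values). $\mathfrak{R}_n$ denotes the set of fixed-point-free $321$-avoiding permutations $\pi$ of $[n]$ such that every LR maximum $\pi_i$ satisfies $i<n$ and $\pi_i>\pi_{i+1}$ (equivalently, the $321$-avoiding permutations in which every LR maximum is a descent). Tableaux. $\mathrm{SYT}_{\le3}(n)$ is the set of standard Young tableaux with $n$ cells and at most three rows; the shape is written $(\lambda_1,\lambda_2,\lambda_3)$ with $\lambda_1\ge\lambda_2\ge\lambda_3\ge0$, $\lambda_1+\lambda_2+\lambda_3=n$. $\mathrm{SYT}^{\equiv}_{\le 3}(n)$ is the subset of those with $\lambda_1\equiv\lambda_2\equiv\lambda_3\pmod 2$ (empty rows are included and counted as even). The permutation $\theta(\pi)$. Let $\pi\in\mathfrak{R}_n$ have LR maxima $m_1<\cdots<m_k=n$, so $k=|\mathrm{LR}(\pi)|$. For $1\le j\le k-1$ let $a_j$ be the largest entry of $\pi$ located strictly between $m_j$ and $m_{j+1}$, and let $a_k=\pi_n$ be the last entry. Let $A(\pi)=\{a_1,\dots,a_k\}$, $r=n-2k$, and let $b_1<\cdots<b_r$ be the elements of $\{1,\dots,n\}\setminus(A(\pi)\cup\mathrm{LR}(\pi))$.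 Define, in one-line notation, $\theta(\pi)=m_1\,a_1\,m_2\,a_2\cdots m_k\,a_k\,b_1\cdots b_r$. Let $P(\theta(\pi))$ be the Robinson–Schensted insertion tableau (row insertion) of $\theta(\pi)$; it has at most three rows. Parity correction. On tableaux of shape $(\lambda_1,\lambda_2,\lambda_3)$ with $n$ cells consider two moves: (M1) (applied when $\lambda_3>0$ and $\lambda_3\not\equiv n\pmod 2$) Let $y$ be the last entry of row 3 and $x$ the largest entry of row 2 with $x<y$. Remove $y$ from row 3, replace $x$ by $y$ in row 2, and append $x$ to the end of row 1. The shape becomes $(\lambda_1+1,\lambda_2,\lambda_3-1)$. (M2) (applied when $\lambda_2>0$ and $\lambda_2\not\equiv n\pmod 2$) Move the last entry of row 2 to the end of row 1. The shape becomes $(\lambda_1+1,\lambda_2-1,\lambda_3)$. A nonempty row whose length is not congruent to $n$ mod $2$ is called defective. $\Psi(T)$ is the result of applying (M1) to $T$ if row 3 is defective, and then applying (M2) if the resulting row 2 is defective. The map $\Phi$. For $\pi\in\mathfrak{R}_n$, $\Phi(\pi)=P(\theta(\pi))$ if the three row lengths of $P(\theta(\pi))$ have equal parity, and $\Phi(\pi)=\Psi(P(\theta(\pi)))$ otherwise. *)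

theory Defs
  imports
    "HOL-Combinatorics.Permutations"
    "HOL-Number_Theory.Cong"
    "HOL-Library.More_List"
begin

text \<open>
  A permutation of \<open>[n]\<close> is a function \<open>\<pi>\<close> with \<open>\<pi> permutes {1..n}\<close>; the entry in position \<open>i\<close>
  of its one-line notation is \<open>\<pi> i\<close>, and the entry \<open>v\<close> stands in position \<open>inv \<pi> v\<close>.
\<close>

definition LR_positions :: "nat \<Rightarrow> (nat \<Rightarrow> nat) \<Rightarrow> nat set" where
  "LR_positions n \<pi> = {i \<in> {1..n}. \<forall>j \<in> {1..<i}. \<pi> j < \<pi> i}"

definition LR :: "nat \<Rightarrow> (nat \<Rightarrow> nat) \<Rightarrow> nat set" where
  "LR n \<pi> = \<pi> ` LR_positions n \<pi>"

definition avoids_321 :: "nat \<Rightarrow> (nat \<Rightarrow> nat) \<Rightarrow> bool" where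
  "avoids_321 n \<pi> \<longleftrightarrow>
     \<not> (\<exists>i j k. 1 \<le> i \<and> i < j \<and> j < k \<and> k \<le> n \<and> \<pi> i > \<pi> j \<and> \<pi> j > \<pi> k)"

definition frakR :: "nat \<Rightarrow> (nat \<Rightarrow> nat) set" where
  "frakR n = {\<pi>. \<pi> permutes {1..n} \<and> (\<forall>i \<in> {1..n}. \<pi> i \<noteq> i) \<and> avoids_321 n \<pi>
                 \<and> (\<forall>i \<in> LR_positions n \<pi>. i < n \<and> \<pi> i > \<pi> (i + 1))}"

text \<open>\<open>lr_max n \<pi> j\<close> and \<open>a_entry n \<pi> j\<close> are $m_j$ and $a_j$, for \<open>1 \<le> j \<le> k\<close>.\<close>

definition lr_max :: "nat \<Rightarrow> (nat \<Rightarrow> nat) \<Rightarrow> nat \<Rightarrow> nat" where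
  "lr_max n \<pi> j = sorted_list_of_set (LR n \<pi>) ! (j - 1)"

definition a_entry :: "nat \<Rightarrow> (nat \<Rightarrow> nat) \<Rightarrow> nat \<Rightarrow> nat" where
  "a_entry n \<pi> j =
     (if j < card (LR n \<pi>)
      then Max (\<pi> ` {inv \<pi> (lr_max n \<pi> j) <..< inv \<pi> (lr_max n \<pi> (j + 1))})
      else \<pi> n)"

definition A_set :: "nat \<Rightarrow> (nat \<Rightarrow> nat) \<Rightarrow> nat set" where
  "A_set n \<pi> = a_entry n \<pi> ` {1..card (LR n \<pi>)}"

definition theta :: "nat \<Rightarrow> (nat \<Rightarrow> nat) \<Rightarrow> nat list" where
  "theta n \<pi> =
     concat (map (\<lambda>j. [lr_max n \<pi> j, a_entry n \<pi> j]) [1..<card (LR n \<pi>) + 1])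
     @ sorted_list_of_set ({1..n} - (A_set n \<pi> \<union> LR n \<pi>))"

text \<open>
  A tableau is the list of its nonempty rows, from top to bottom. The rows are numbered from 1 by
  \<open>row\<close>, which returns the empty list for rows that are absent, so that the shape of a tableau with
  at most three rows is \<open>(length (row T 1), length (row T 2), length (row T 3))\<close>.
\<close>

type_synonym tableau = "nat list list"

definition row :: "tableau \<Rightarrow> nat \<Rightarrow> nat list" where
  "row T i = (if 1 \<le> i \<and> i \<le> length T then T ! (i - 1) else [])"

text \<open>Rows emptied by a move are dropped from the end of the list.\<close>

definition of_rows :: "nat list list \<Rightarrow> tableau" where
  "of_rows rs = strip_while (\<lambda>r. r = []) rs"

definition cells :: "tableau \<Rightarrow> nat" where
  "cells T = sum_list (map length T)"

definition SYT :: "nat \<Rightarrow> tableau set" where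
  "SYT n = {T.
     (\<forall>r \<in> set T. r \<noteq> []) \<and>
     sorted_wrt (\<ge>) (map length T) \<and>
     distinct (concat T) \<and> set (concat T) = {1..n} \<and>
     (\<forall>r \<in> set T. sorted_wrt (<) r) \<and>
     (\<forall>i j. i + 1 < length T \<longrightarrow> j < length (T ! (i + 1)) \<longrightarrow> T ! i ! j < T ! (i + 1) ! j)}"

definition SYT_le3 :: "nat \<Rightarrow> tableau set" where
  "SYT_le3 n = {T \<in> SYT n. length T \<le> 3}"

definition equal_parity :: "tableau \<Rightarrow> bool" where
  "equal_parity T \<longleftrightarrow>
     [length (row T 1) = length (row T 2)] (mod 2) \<and>
     [length (row T 2) = length (row T 3)] (mod 2)"

definition SYT_le3_eqpar :: "nat \<Rightarrow> tableau set" where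
  "SYT_le3_eqpar n = {T \<in> SYT_le3 n. equal_parity T}"

text \<open>\<open>row_bump x r\<close> is the row after inserting \<open>x\<close> together with the entry bumped out, if any.\<close>

fun row_bump :: "nat \<Rightarrow> nat list \<Rightarrow> nat list \<times> nat option" where
  "row_bump x [] = ([x], None)"
| "row_bump x (y # ys) =
     (if x < y then (x # ys, Some y)
      else (case row_bump x ys of (zs, b) \<Rightarrow> (y # zs, b)))"

fun row_insert :: "nat \<Rightarrow> tableau \<Rightarrow> tableau" where
  "row_insert x [] = [[x]]"
| "row_insert x (r # T) =
     (case row_bump x r of
        (r', None) \<Rightarrow> r' # T
      | (r', Some y) \<Rightarrow> r' # row_insert y T)"

definition P_tableau :: "nat list \<Rightarrow> tableau" where
  "P_tableau w = fold row_insert w []"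

definition move_M1 :: "tableau \<Rightarrow> tableau" where
  "move_M1 T =
     (let y = last (row T 3);
          x = Max {z \<in> set (row T 2). z < y}
      in of_rows [row T 1 @ [x],
                  map (\<lambda>z. if z = x then y else z) (row T 2),
                  butlast (row T 3)])"

definition move_M2 :: "tableau \<Rightarrow> tableau" where
  "move_M2 T =
     of_rows [row T 1 @ [last (row T 2)], butlast (row T 2), row T 3]"

definition defective :: "tableau \<Rightarrow> nat \<Rightarrow> bool" where
  "defective T i \<longleftrightarrow> row T i \<noteq> [] \<and> \<not> [length (row T i) = cells T] (mod 2)"

definition Psi :: "tableau \<Rightarrow> tableau" where
  "Psi T =
     (let T' = (if defective T 3 then move_M1 T else T)
      in if defective T' 2 then move_M2 T' else T')"

definition Phi :: "nat \<Rightarrow> (nat \<Rightarrow> nat) \<Rightarrow> tableau" where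
  "Phi n \<pi> =
     (let T = P_tableau (theta n \<pi>)
      in if equal_parity T then T else Psi T)"

end

theory Submission
  imports Defs
begin

text \<open>
  The map $\Phi$ is a composition of three bijections between sets of words. A permutation
  $\pi \in \mathfrak{R}_n$ is encoded by the word that marks each value as an entry $a_j$
  (\<open>Up\<close>), a left-to-right maximum (\<open>Down\<close>) or neither (\<open>Level\<close>). A tableau is encoded by the Yamanouchi
  word that gives the row of each value.

  First, a permutation in $\mathfrak{R}_n$ falls into blocks, each consisting of a
  left-to-right maximum and a nonempty list of smaller entries, and the entries other than maxima
  increase from left to right. The last entry of a block is $a_j$. So the sets of the $m_j$ and the
  $a_j$ determine where the increasing sequence of other entries must be cut, and hence $\pi$. The
  only conditions on these sets are $a_j < m_j$, which makes the word a lattice path from height 0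
  to height 0 that stays nonnegative, and that no other non-maximum exceeds $a_k$, so that there is no
  level step after the last up step (\<open>good_step_word\<close>, \<open>step_word_inject\<close>, \<open>step_word_surj\<close>).

  Second, inserting $m_1 a_1 \cdots m_k a_k$ gives a rectangle with rows $a_1 \cdots a_k$ and
  $m_1 \cdots m_k$, and the increasing sequence $b_1 \cdots b_r$ is then pushed through it row by row.
  Following this process as the values are added in increasing order, it is enough to remember how
  many inserted entries are currently resting at the end of row 1 and of row 2: a new largest entry
  of that row is bumped exactly when this number is positive. This gives an automaton with
  two counters that can also be run backwards (\<open>run_reversible\<close>, \<open>run_bump_all\<close>). It turns the
  paths into Yamanouchi words, and the condition on level steps becomes the following: rows 1
  and 2 have the same length, or after the last \<open>R1\<close> some \<open>R2\<close> is followed by an \<open>R3\<close>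
  (\<open>run_reachable\<close>, \<open>reachable_run\<close>).

  Third, on these words $\Psi$ is a local rewriting near the end of the word. In usual reading order it is
  one of \<open>R2 R3\<^sup>i R3 R2\<^sup>j \<mapsto> R1 R3\<^sup>i R2 R2\<^sup>j\<close> for \<open>M1\<close>, \<open>R2 R3\<^sup>i \<mapsto> R1 R3\<^sup>i\<close> for \<open>M2\<close>, and
  \<open>R2 R3\<^sup>i R3 R2\<^sup>j \<mapsto> R1 R3\<^sup>i R2\<^sup>j R1\<close> for both. The results of a genuine change never satisfy
  the condition on reachable words, so they do not collide with unchanged words. The exponents at the
  end of the result reveal the rule in all cases but one, which is settled by the difference of the first two
  row lengths together with the letters before the last \<open>R1\<close> (\<open>corrects_surj\<close>, \<open>corrects_inject\<close>).
\<close>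

section \<open>Words and the positions of their letters\<close>

text \<open>
  A word assigns a letter to each value \<open>1, \<dots>, n\<close> and is written backwards: its head is the
  letter of the largest value. Every structural induction below is therefore an induction that adds a
  new largest entry, which is how row insertion, ballot conditions and standard tableaux all behave
  well.
\<close>

fun positions :: "'a \<Rightarrow> 'a list \<Rightarrow> nat list" where
  "positions x [] = []"
| "positions x (y # w) = positions x w @ (if y = x then [Suc (length w)] else [])"

text \<open>
  Suffixes of a backward word are initial segments in the usual reading order, so this is the
  usual lattice condition: no initial segment has more letters \<open>y\<close> than letters \<open>x\<close>.
\<close>

fun ballot :: "'a \<Rightarrow> 'a \<Rightarrow> 'a list \<Rightarrow> bool" where
  "ballot x y [] = True"
| "ballot x y (z # w) = (ballot x y w \<and> count_list (z # w) y \<le> count_list (z # w) x)"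

lemma set_positions: "set (positions x w) = {k \<in> {1..length w}. w ! (length w - k) = x}"
proof (induction w)
  case (Cons y w)
  have "k \<le> length w \<Longrightarrow> Suc (length w) - k = Suc (length w - k)" for k
    by simp
  then show ?case using Cons
    by (auto simp: le_Suc_eq)
qed simp

lemma positions_le: "k \<in> set (positions x w) \<Longrightarrow> 1 \<le> k \<and> k \<le> length w"
  by (simp add: set_positions)

lemma positions_less: "\<forall>k \<in> set (positions x w). k < Suc (length w)"
  by (auto dest: positions_le)

lemma sorted_positions: "sorted_wrt (<) (positions x w)"
  by (induction w) (auto simp: sorted_wrt_append le_imp_less_Suc dest: positions_le)

lemma distinct_positions: "distinct (positions x w)"
  using sorted_positions[of x w] by (simp add: strict_sorted_iff)

lemma length_positions [simp]: "length (positions x w) = count_list w x"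
  by (induction w) auto

lemma positions_eq_Nil: "positions x w = [] \<longleftrightarrow> count_list w x = 0"
  by (metis length_positions length_0_conv)

lemma positions_disjoint: "x \<noteq> y \<Longrightarrow> set (positions x w) \<inter> set (positions y w) = {}"
  by (auto simp: set_positions)

lemma positions_append:
  "positions x (u @ w) = positions x w @ map (\<lambda>k. k + length w) (positions x u)"
  by (induction u) auto

lemma positions_replicate:
  "positions x (replicate j y) = (if x = y then [1..<Suc j] else [])"
  by (induction j) auto

lemma positions_map_rev_upt:
  "positions x (map f (rev [1..<Suc n])) = filter (\<lambda>k. f k = x) [1..<Suc n]"
  by (induction n) auto

lemma positions_inject:
  assumes "length u = length w" and "\<And>x. set (positions x u) = set (positions x w)"
  shows "u = w"
proof (rule nth_equalityI[OF assms(1)])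
  fix i assume i: "i < length u"
  define k where "k = length u - i"
  have k: "1 \<le> k" "k \<le> length u" "length u - k = i"
    using i by (auto simp: k_def)
  then have "k \<in> set (positions (u ! i) u)"
    by (simp add: set_positions)
  then show "u ! i = w ! i"
    using assms k by (auto simp: set_positions)
qed

lemma ballot_count: "ballot x y w \<Longrightarrow> count_list w y \<le> count_list w x"
  by (cases w) auto

text \<open>
  Both the column condition of a tableau and the inequalities $a_j < m_j$ have the form on the
  right-hand side. The equivalence holds because the \<open>i\<close>-th \<open>y\<close> is preceded by at least \<open>i\<close> letters
  \<open>x\<close> exactly when the \<open>i\<close>-th \<open>x\<close> comes before it.
\<close>

lemma ballot_iff_positions:
  "ballot x y w \<longleftrightarrow> count_list w y \<le> count_list w x \<and>
     (\<forall>i < count_list w y. positions x w ! i < positions y w ! i)" if "x \<noteq> y"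
proof (induction w)
  case (Cons z w)
  consider "z = y" | "z = x" | "z \<noteq> x" "z \<noteq> y" by blast
  then show ?case
  proof cases
    case 1
    show ?thesis
    proof
      assume "ballot x y (z # w)"
      then have b: "ballot x y w" "Suc (count_list w y) \<le> count_list w x"
        using 1 that by auto
      have "positions x w ! count_list w y \<in> set (positions x w)"
        using b by (simp add: Suc_le_eq)
      then have "positions x w ! count_list w y < Suc (length w)"
        using positions_le by (metis le_imp_less_Suc)
      then show "count_list (z # w) y \<le> count_list (z # w) x \<and>
          (\<forall>i < count_list (z # w) y. positions x (z # w) ! i < positions y (z # w) ! i)"
        using b Cons 1 that by (auto simp: nth_append less_Suc_eq)
    next
      assume *: "count_list (z # w) y \<le> count_list (z # w) x \<and>
          (\<forall>i < count_list (z # w) y. positions x (z # w) ! i < positions y (z # w) ! i)"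
      then have "\<forall>i < count_list w y. positions x w ! i < positions y w ! i"
        using 1 that by (fastforce simp: nth_append less_Suc_eq)
      then show "ballot x y (z # w)"
        using Cons * 1 that by auto
    qed
  next
    case 2
    show ?thesis
    proof
      assume "ballot x y (z # w)"
      then show "count_list (z # w) y \<le> count_list (z # w) x \<and>
          (\<forall>i < count_list (z # w) y. positions x (z # w) ! i < positions y (z # w) ! i)"
        using Cons 2 that ballot_count[of x y w] by (auto simp: nth_append)
    next
      assume *: "count_list (z # w) y \<le> count_list (z # w) x \<and>
          (\<forall>i < count_list (z # w) y. positions x (z # w) ! i < positions y (z # w) ! i)"
      have le: "count_list w y \<le> count_list w x"
      proof (rule ccontr)
        assume "\<not> ?thesis"
        then have "count_list w x < count_list w y" by simp
        moreover from this have "positions y w ! count_list w x \<in> set (positions y w)"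
          by simp
        then have "positions y w ! count_list w x \<le> length w"
          using positions_le by metis
        ultimately show False
          using * 2 that by (auto simp: nth_append)
      qed
      then show "ballot x y (z # w)"
        using Cons * 2 that by (auto simp: nth_append)
    qed
  next
    case 3
    then show ?thesis using Cons ballot_count[of x y w] by auto
  qed
qed simp

lemma count_list_replicate: "count_list (replicate j z) x = (if z = x then j else 0)"
  by (induction j) auto

lemma ballot_replicate_append:
  assumes "x \<noteq> y"
  shows "ballot x y (replicate j z @ w) \<longleftrightarrow>
    ballot x y w \<and> (z = y \<longrightarrow> count_list w y + j \<le> count_list w x)"
  using assms ballot_count[of x y w]
  by (induction j) (auto simp: count_list_append count_list_replicate)

section \<open>Row insertion of increasing sequences\<close>

text \<open>
  The final row together with the sequence of bumped entries, in the order in which they leave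
  the row and enter the next one.
\<close>

fun bump_all :: "nat list \<Rightarrow> nat list \<Rightarrow> nat list \<times> nat list" where
  "bump_all r [] = (r, [])"
| "bump_all r (x # xs) =
     (case row_bump x r of
        (r', None) \<Rightarrow> bump_all r' xs
      | (r', Some y) \<Rightarrow> (case bump_all r' xs of (r'', ys) \<Rightarrow> (r'', y # ys)))"

text \<open>
  The entries that leave a row do not depend on the rows below it, so a whole sequence can be
  pushed through a tableau one row at a time. This reduces the insertion tableau to two applications of
  \<open>bump_all\<close>.
\<close>

lemma fold_row_insert_Cons:
  "bump_all r xs = (r', ys) \<Longrightarrow> fold row_insert xs (r # T) = r' # fold row_insert ys T"
  by (induction r xs arbitrary: r' ys T rule: bump_all.induct)
    (auto split: prod.splits option.splits)

lemma row_bump_append: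
  assumes "\<forall>y \<in> set r. y < x"
  shows "row_bump x (r @ s) = (r @ fst (row_bump x s), snd (row_bump x s))"
  using assms by (induction r) (auto split: prod.splits)

lemma row_bump_None: "row_bump x r = (r', None) \<longleftrightarrow> r' = r @ [x] \<and> (\<forall>y \<in> set r. y \<le> x)"
proof
  show "row_bump x r = (r', None)" if "r' = r @ [x] \<and> (\<forall>y \<in> set r. y \<le> x)"
  proof -
    have "\<forall>y \<in> set r. y \<le> x \<Longrightarrow> row_bump x r = (r @ [x], None)"
      by (induction r) auto
    with that show ?thesis by simp
  qed
  show "row_bump x r = (r', None) \<Longrightarrow> r' = r @ [x] \<and> (\<forall>y \<in> set r. y \<le> x)"
    by (induction r arbitrary: r') (auto split: prod.splits if_splits)
qed

lemma row_bump_Some: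
  "row_bump x r = (r', Some y) \<Longrightarrow> insert y (set r') = insert x (set r)"
proof (induction r arbitrary: r')
  case (Cons z r)
  show ?case
  proof (cases "x < z")
    case True
    then show ?thesis using Cons.prems by auto
  next
    case False
    then obtain r1 where r1: "row_bump x r = (r1, Some y)" "r' = z # r1"
      using Cons.prems by (auto split: prod.splits)
    then have "insert y (set r1) = insert x (set r)" using Cons.IH by blast
    then show ?thesis using r1(2) by (metis insert_commute list.set(2))
  qed
qed simp

lemma row_bump_snoc_Some:
  "row_bump x r = (r', Some y) \<Longrightarrow> row_bump x (r @ [m]) = (r' @ [m], Some y)"
  by (induction r arbitrary: r') (auto split: prod.splits if_splits)

lemma row_bump_snoc_None:
  "row_bump x r = (r', None) \<Longrightarrow> x < m \<Longrightarrow> row_bump x (r @ [m]) = (r', Some m)"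
  by (induction r arbitrary: r') (auto split: prod.splits if_splits)

lemma bump_all_append:
  "bump_all r xs = (r', ys) \<Longrightarrow>
   bump_all r (xs @ zs) = (fst (bump_all r' zs), ys @ snd (bump_all r' zs))"
  by (induction r xs arbitrary: r' ys rule: bump_all.induct)
    (auto split: prod.splits option.splits)

lemma set_bump_all:
  "bump_all r xs = (r', ys) \<Longrightarrow> set r' \<union> set ys = set r \<union> set xs"
proof (induction r xs arbitrary: r' ys rule: bump_all.induct)
  case (2 r x xs)
  obtain r1 b where b: "row_bump x r = (r1, b)" by fastforce
  show ?case
  proof (cases b)
    case None
    with b have "r1 = r @ [x]" by (simp add: row_bump_None)
    then show ?thesis using 2 b None by auto
  next
    case (Some y)
    obtain r2 zs where z: "bump_all r1 xs = (r2, zs)" by fastforce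
    with 2(3) b Some have "r' = r2" "ys = y # zs" by auto
    moreover have "set r2 \<union> set zs = set r1 \<union> set xs"
      using 2(2)[OF b[symmetric] Some z] .
    moreover have "insert y (set r1) = insert x (set r)"
      using b Some row_bump_Some by simp
    ultimately show ?thesis by auto
  qed
qed simp

lemma bump_all_increasing_above:
  "sorted_wrt (<) xs \<Longrightarrow> \<forall>y \<in> set r. \<forall>x \<in> set xs. y \<le> x \<Longrightarrow> bump_all r xs = (r @ xs, [])"
proof (induction xs arbitrary: r)
  case (Cons x xs)
  have "row_bump x r = (r @ [x], None)"
    using Cons by (subst row_bump_None) auto
  moreover have "bump_all (r @ [x]) xs = ((r @ [x]) @ xs, [])"
    by (rule Cons.IH) (use Cons.prems in auto)
  ultimately show ?case by simp
qed simp

lemma bump_all_snoc: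
  assumes "bump_all r xs = (r', ys)" and "\<forall>y \<in> set r \<union> set xs. y < m"
  shows "bump_all r (xs @ [m]) = (r' @ [m], ys)"
proof -
  have "row_bump m r' = (r' @ [m], None)"
    using assms(2) set_bump_all[OF assms(1)] by (auto simp: row_bump_None intro: less_imp_le)
  then show ?thesis using bump_all_append[OF assms(1), of "[m]"] by simp
qed

text \<open>
  If some inserted entry comes to rest at the end of the row \<open>r\<close>, the first such entry bumps \<open>m\<close>
  instead, and the later ones follow behind it as before; if every inserted entry bumps something in
  \<open>r\<close>, then \<open>m\<close> is never reached. Together with \<open>bump_all_snoc\<close>, this describes how the result changes
  when a new largest entry joins the row or the inserted sequence.
\<close>

lemma bump_all_row_snoc:
  assumes "bump_all r xs = (r', ys)" and "sorted_wrt (<) xs" and "\<forall>y \<in> set xs. y < m"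
  shows "bump_all (r @ [m]) xs =
    (if length ys < length xs then (r', ys @ [m]) else (r' @ [m], ys)) \<and> length ys \<le> length xs"
  using assms
proof (induction r xs arbitrary: r' ys rule: bump_all.induct)
  case (2 r x xs)
  obtain r1 b where b: "row_bump x r = (r1, b)" by fastforce
  show ?case
  proof (cases b)
    case None
    with b have r1: "r1 = r @ [x]" "\<forall>y \<in> set r. y \<le> x" by (simp_all add: row_bump_None)
    have "bump_all r1 xs = (r1 @ xs, [])"
      by (rule bump_all_increasing_above) (use 2 r1 in fastforce)+
    then show ?thesis using 2 b None row_bump_snoc_None[of x r r1 m] by auto
  next
    case (Some y)
    then show ?thesis using 2(2)[OF b[symmetric] Some] 2(3-) b row_bump_snoc_Some[of x r r1 y m]
      by (auto split: prod.splits)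
  qed
qed simp

section \<open>The reversible automaton behind the insertion\<close>

text \<open>
  The values $a_j$ are up steps, the left-to-right maxima are down steps and the remaining values
  are level steps of a lattice path.
\<close>

datatype step = Up | Down | Level

datatype row_label = R1 | R2 | R3

text \<open>
  \<open>run u v p q\<close> records that inserting the \<open>Level\<close> values of \<open>u\<close> into the two-row tableau with rows
  \<open>Up\<close> and \<open>Down\<close> puts the values into the rows given by \<open>v\<close>. The state counts the
  insertions that have come to rest at the end of a row: \<open>p\<close> in row 1 and \<open>q\<close> in row 2. As long as such
  an insertion is pending, a new largest entry of that row is bumped to the next row.

  Each rule is determined by its input letter and the old state, and also by its output letter and the
  new state: \<open>R1\<close> comes from \<open>Level\<close> or \<open>Up\<close> according to whether the new \<open>p\<close> is positive, \<open>R2\<close> comes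
  from \<open>Up\<close> or \<open>Down\<close> according to whether the new \<open>q\<close> is positive, and \<open>R3\<close> only comes from \<open>Down\<close>.
  So the automaton can be run backwards from its final state.
\<close>

inductive run :: "step list \<Rightarrow> row_label list \<Rightarrow> nat \<Rightarrow> nat \<Rightarrow> bool" where
  Nil: "run [] [] 0 0"
| Level: "run u v p q \<Longrightarrow> run (Level # u) (R1 # v) (Suc p) q"
| Up_stays: "run u v 0 q \<Longrightarrow> run (Up # u) (R1 # v) 0 q"
| Up_bumped: "run u v (Suc p) q \<Longrightarrow> run (Up # u) (R2 # v) p (Suc q)"
| Down_stays: "run u v p 0 \<Longrightarrow> run (Down # u) (R2 # v) p 0"
| Down_bumped: "run u v p (Suc q) \<Longrightarrow> run (Down # u) (R3 # v) p q"

lemma run_length: "run u v p q \<Longrightarrow> length u = length v"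
  by (induction rule: run.induct) auto

lemma run_deterministic: "run u v p q \<Longrightarrow> run u v' p' q' \<Longrightarrow> v = v' \<and> p = p' \<and> q = q'"
proof (induction arbitrary: v' p' q' rule: run.induct)
  case Nil
  then show ?case by (auto elim: run.cases)
next
  case (Level u v p q)
  from Level.prems Level.IH show ?case by (cases rule: run.cases) blast+
next
  case (Up_stays u v q)
  from Up_stays.prems Up_stays.IH show ?case by (cases rule: run.cases) blast+
next
  case (Up_bumped u v p q)
  from Up_bumped.prems Up_bumped.IH show ?case by (cases rule: run.cases) blast+
next
  case (Down_stays u v p)
  from Down_stays.prems Down_stays.IH show ?case by (cases rule: run.cases) blast+
next
  case (Down_bumped u v p q)
  from Down_bumped.prems Down_bumped.IH show ?case by (cases rule: run.cases) blast+
qed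

lemma run_reversible: "run u v p q \<Longrightarrow> run u' v p q \<Longrightarrow> u = u'"
proof (induction arbitrary: u' rule: run.induct)
  case Nil
  then show ?case by (auto elim: run.cases)
next
  case (Level u v p q)
  from Level.prems Level.IH show ?case by (cases rule: run.cases) blast+
next
  case (Up_stays u v q)
  from Up_stays.prems Up_stays.IH show ?case by (cases rule: run.cases) blast+
next
  case (Up_bumped u v p q)
  from Up_bumped.prems Up_bumped.IH show ?case by (cases rule: run.cases) blast+
next
  case (Down_stays u v p)
  from Down_stays.prems Down_stays.IH show ?case by (cases rule: run.cases) blast+
next
  case (Down_bumped u v p q)
  from Down_bumped.prems Down_bumped.IH show ?case by (cases rule: run.cases) blast+
qed

lemma run_exists_forward: "\<exists>v p q. run u v p q"
proof (induction u)
  case Nil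
  then show ?case using run.Nil by blast
next
  case (Cons x u)
  then obtain v p q where "run u v p q" by blast
  then show ?case
    by (cases x; cases p; cases q) (blast intro: run.intros)+
qed

text \<open>
  Running backwards keeps $p \le \#R1 - \#R2$ and $q \le \#R2 - \#R3$ for the remaining initial
  segment of a Yamanouchi word: a letter that lowers the right-hand side of one of these inequalities
  also lowers its left-hand side, unless that is already zero. Hence both counters vanish when the word is used up, which is the
  starting state.
\<close>

lemma run_exists_backward:
  assumes "ballot R1 R2 v" and "ballot R2 R3 v"
    and "count_list v R2 + p \<le> count_list v R1" and "count_list v R3 + q \<le> count_list v R2"
  shows "\<exists>u. run u v p q"
  using assms
proof (induction v arbitrary: p q)
  case Nil
  then show ?case using run.Nil by auto
next
  case (Cons x v)
  note b = ballot_count[of R1 R2 v] ballot_count[of R2 R3 v]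
  show ?case
  proof (cases x)
    case R1
    show ?thesis
    proof (cases p)
      case 0
      then have "\<exists>u. run u v 0 q" using Cons.prems R1 b by (intro Cons.IH) auto
      then show ?thesis using R1 0 run.intros by blast
    next
      case (Suc p')
      then have "\<exists>u. run u v p' q" using Cons.prems R1 b by (intro Cons.IH) auto
      then show ?thesis using R1 Suc run.intros by blast
    qed
  next
    case R2
    show ?thesis
    proof (cases q)
      case 0
      then have "\<exists>u. run u v p 0" using Cons.prems R2 b by (intro Cons.IH) auto
      then show ?thesis using R2 0 run.intros by blast
    next
      case (Suc q')
      then have "\<exists>u. run u v (Suc p) q'" using Cons.prems R2 b by (intro Cons.IH) auto
      then show ?thesis using R2 Suc run.intros by blast
    qed
  next
    case R3
    then have "\<exists>u. run u v p (Suc q)" using Cons.prems b by (intro Cons.IH) auto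
    then show ?thesis using R3 run.intros by blast
  qed
qed

lemma run_counts:
  assumes "run u v p q"
  shows "count_list v R1 + q + count_list u Down = count_list v R2 + p + count_list u Up"
    and "count_list v R2 = q + count_list u Down"
    and "count_list v R3 + q \<le> count_list v R2"
  using assms by (induction rule: run.induct) auto

text \<open>
  The height $\#Up - \#Down$ of the path is at least \<open>q\<close>, since a \<open>Down\<close> step that lowers the
  height either lowers \<open>q\<close> as well or happens when \<open>q\<close> is zero. By \<open>run_counts\<close> this bound gives
  the inequality between the first two rows.
\<close>

lemma run_ballot_out:
  assumes "run u v p q" and "ballot Up Down u"
  shows "ballot R1 R2 v \<and> ballot R2 R3 v \<and> count_list u Down + q \<le> count_list u Up"
  using assms
proof (induction rule: run.induct)
  case (Up_bumped u v p q)
  then show ?case using run_counts[OF Up_bumped.hyps(1)] by auto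
next
  case (Down_stays u v p)
  then show ?case using run_counts[OF Down_stays.hyps(1)] by auto
next
  case (Down_bumped u v p q)
  then show ?case using run_counts[OF Down_bumped.hyps(1)] by auto
next
  case (Level u v p q)
  then show ?case using ballot_count[of R1 R2 v] ballot_count[of R2 R3 v] by simp
next
  case (Up_stays u v q)
  then show ?case using ballot_count[of R1 R2 v] ballot_count[of R2 R3 v] by simp
qed simp

text \<open>
  The converse: under the bound $p \le \#R1 - \#R2$, which is preserved when running backwards, the
  height of the path is at least \<open>q\<close> and so never negative.
\<close>

lemma run_ballot_in:
  assumes "run u v p q" and "ballot R1 R2 v" and "count_list v R2 + p \<le> count_list v R1"
  shows "ballot Up Down u"
  using assms
proof (induction rule: run.induct)
  case (Level u v p q)
  then show ?case by (auto dest: ballot_count)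
next
  case (Up_stays u v q)
  then show ?case using run_counts[OF Up_stays.hyps(1)] by (auto dest: ballot_count)
next
  case (Up_bumped u v p q)
  then show ?case using run_counts[OF Up_bumped.hyps(1)] by (auto dest: ballot_count)
next
  case (Down_stays u v p)
  then show ?case using run_counts[OF Down_stays.hyps(1)] by (auto dest: ballot_count)
next
  case (Down_bumped u v p q)
  then show ?case using run_counts[OF Down_bumped.hyps(1)] by (auto dest: ballot_count)
qed simp

text \<open>
  The sequence \<open>c\<close> consists of the entries bumped out of row 1. It is increasing, so the lemmas on
  adding a largest entry apply to both rows.
\<close>

lemma run_bump_all:
  assumes "run u v p q"
  shows "\<exists>c. sorted_wrt (<) c \<and> set c \<subseteq> {1..length u} \<and>
    bump_all (positions Up u) (positions Level u) = (positions R1 v, c) \<and>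
    bump_all (positions Down u) c = (positions R2 v, positions R3 v) \<and>
    length (positions Level u) = length c + p \<and> length c = length (positions R3 v) + q"
  using assms
proof (induction rule: run.induct)
  case (Level u v p q)
  then obtain c where c: "sorted_wrt (<) c" "set c \<subseteq> {1..length u}"
    "bump_all (positions Up u) (positions Level u) = (positions R1 v, c)"
    "bump_all (positions Down u) c = (positions R2 v, positions R3 v)"
    "length (positions Level u) = length c + p" "length c = length (positions R3 v) + q"
    by blast
  have "bump_all (positions Up u) (positions Level u @ [Suc (length u)])
      = (positions R1 v @ [Suc (length u)], c)"
    by (rule bump_all_snoc[OF c(3)]) (use positions_less[of Up u] positions_less[of Level u] in auto)
  then show ?case using c run_length[OF Level.hyps] by (intro exI[of _ c]) auto
next
  case (Up_stays u v q)
  then obtain c where c: "sorted_wrt (<) c" "set c \<subseteq> {1..length u}"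
    "bump_all (positions Up u) (positions Level u) = (positions R1 v, c)"
    "bump_all (positions Down u) c = (positions R2 v, positions R3 v)"
    "length (positions Level u) = length c" "length c = length (positions R3 v) + q"
    by auto
  have "bump_all (positions Up u @ [Suc (length u)]) (positions Level u)
      = (positions R1 v @ [Suc (length u)], c)"
    using bump_all_row_snoc[OF c(3) sorted_positions positions_less] c by auto
  then show ?case using c run_length[OF Up_stays.hyps] by (intro exI[of _ c]) auto
next
  case (Up_bumped u v p q)
  then obtain c where c: "sorted_wrt (<) c" "set c \<subseteq> {1..length u}"
    "bump_all (positions Up u) (positions Level u) = (positions R1 v, c)"
    "bump_all (positions Down u) c = (positions R2 v, positions R3 v)"
    "length (positions Level u) = length c + Suc p" "length c = length (positions R3 v) + q"
    by auto
  have 1: "bump_all (positions Up u @ [Suc (length u)]) (positions Level u)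
      = (positions R1 v, c @ [Suc (length u)])"
    using bump_all_row_snoc[OF c(3) sorted_positions positions_less] c by auto
  have 2: "bump_all (positions Down u) (c @ [Suc (length u)])
      = (positions R2 v @ [Suc (length u)], positions R3 v)"
    by (rule bump_all_snoc[OF c(4)]) (use c(2) in \<open>fastforce dest: positions_le\<close>)
  have 3: "\<forall>k \<in> set c. k < Suc (length u)" using c(2) by fastforce
  show ?case using 1 2 3 c run_length[OF Up_bumped.hyps]
    by (intro exI[of _ "c @ [Suc (length u)]"]) (auto simp: sorted_wrt_append)
next
  case (Down_stays u v p)
  then obtain c where c: "sorted_wrt (<) c" "set c \<subseteq> {1..length u}"
    "bump_all (positions Up u) (positions Level u) = (positions R1 v, c)"
    "bump_all (positions Down u) c = (positions R2 v, positions R3 v)"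
    "length (positions Level u) = length c + p" "length c = length (positions R3 v)"
    by auto
  have "bump_all (positions Down u @ [Suc (length u)]) c
      = (positions R2 v @ [Suc (length u)], positions R3 v)"
    using bump_all_row_snoc[OF c(4,1), of "Suc (length u)"] c by fastforce
  then show ?case using c run_length[OF Down_stays.hyps] by (intro exI[of _ c]) auto
next
  case (Down_bumped u v p q)
  then obtain c where c: "sorted_wrt (<) c" "set c \<subseteq> {1..length u}"
    "bump_all (positions Up u) (positions Level u) = (positions R1 v, c)"
    "bump_all (positions Down u) c = (positions R2 v, positions R3 v)"
    "length (positions Level u) = length c + p" "length c = length (positions R3 v) + Suc q"
    by auto
  have "bump_all (positions Down u @ [Suc (length u)]) c
      = (positions R2 v, positions R3 v @ [Suc (length u)])"
    using bump_all_row_snoc[OF c(4,1), of "Suc (length u)"] c by fastforce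
  then show ?case using c run_length[OF Down_bumped.hyps] by (intro exI[of _ c]) auto
qed auto

text \<open>
  For \<open>q = 0\<close> this says that, after the last \<open>R1\<close> in reading order, some \<open>R2\<close> is followed by an
  \<open>R3\<close>. The parameter counts letters \<open>R3\<close> already passed on the way back from the end.
\<close>

fun pair23 :: "nat \<Rightarrow> row_label list \<Rightarrow> bool" where
  "pair23 q [] = False"
| "pair23 q (R1 # v) = False"
| "pair23 q (R2 # v) = (q > 0 \<or> pair23 q v)"
| "pair23 q (R3 # v) = pair23 (Suc q) v"

text \<open>
  Going backwards, the last \<open>R1\<close> is a \<open>Level\<close> step exactly when \<open>p\<close> is still positive there, and an
  \<open>R2\<close> is an \<open>Up\<close> step exactly when an unmatched \<open>R3\<close> has been seen. This translates the condition that
  no \<open>Level\<close> value exceeds all \<open>Up\<close> values into a condition on the tableau.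
\<close>

lemma run_last_Up:
  "run u v p q \<Longrightarrow> Level \<notin> set (takeWhile (\<lambda>x. x \<noteq> Up) u) \<longleftrightarrow> p = 0 \<or> pair23 q v"
  by (induction rule: run.induct) auto

section \<open>Tableaux as Yamanouchi words\<close>

lemma row_of_rows: "row (of_rows [a, b, c]) 1 = a" "row (of_rows [a, b, c]) 2 = b"
  "row (of_rows [a, b, c]) 3 = c"
  by (auto simp: row_def of_rows_def strip_while_def)

lemma cells_of_rows: "cells (of_rows [a, b, c]) = length a + length b + length c"
  by (auto simp: cells_def of_rows_def strip_while_def)

lemma all_rows_less:
  "(\<forall>i j. i < Suc 0 \<longrightarrow> Q i j) \<longleftrightarrow> (\<forall>j. Q 0 j)"
  "(\<forall>i j. i < Suc (Suc 0) \<longrightarrow> Q i j) \<longleftrightarrow> (\<forall>j. Q 0 j) \<and> (\<forall>j. Q (Suc 0) j)"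
  by (auto simp: less_Suc_eq)

text \<open>
  Working with three possibly empty rows avoids treating the shapes with fewer rows separately in
  everything that follows.
\<close>

lemma of_rows_in_SYT_iff:
  "of_rows [a, b, c] \<in> SYT n \<longleftrightarrow>
     length c \<le> length b \<and> length b \<le> length a \<and>
     distinct (a @ b @ c) \<and> set (a @ b @ c) = {1..n} \<and>
     sorted_wrt (<) a \<and> sorted_wrt (<) b \<and> sorted_wrt (<) c \<and>
     (\<forall>j < length b. a ! j < b ! j) \<and> (\<forall>j < length c. b ! j < c ! j)"
proof (cases "c = []"; cases "b = []"; cases "a = []")
qed (auto simp: SYT_def of_rows_def strip_while_def all_rows_less elim!: less_SucE)

lemma SYT_le3_of_rows:
  assumes "T \<in> SYT_le3 n"
  shows "T = of_rows [row T 1, row T 2, row T 3]"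
proof -
  have ne: "\<forall>r \<in> set T. r \<noteq> []" and "length T \<le> 3"
    using assms by (auto simp: SYT_le3_def SYT_def)
  then consider "T = []" | a where "T = [a]" | a b where "T = [a, b]"
    | a b c where "T = [a, b, c]"
    by (cases T rule: list.exhaust; cases "tl T"; cases "tl (tl T)"; cases "tl (tl (tl T))") auto
  then show ?thesis
    by cases (use ne in \<open>auto simp: row_def of_rows_def strip_while_def\<close>)
qed

lemma of_rows_in_SYT_le3_iff: "of_rows [a, b, c] \<in> SYT_le3 n \<longleftrightarrow> of_rows [a, b, c] \<in> SYT n"
  by (auto simp: SYT_le3_def of_rows_def strip_while_def)

definition yamanouchi :: "row_label list \<Rightarrow> bool" where
  "yamanouchi v \<longleftrightarrow> ballot R1 R2 v \<and> ballot R2 R3 v"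

definition tableau_of :: "row_label list \<Rightarrow> tableau" where
  "tableau_of v = of_rows [positions R1 v, positions R2 v, positions R3 v]"

lemma tableau_of_in_SYT:
  assumes "yamanouchi v"
  shows "tableau_of v \<in> SYT_le3 (length v)"
proof -
  have "set (positions R1 v) \<union> set (positions R2 v) \<union> set (positions R3 v) = {1..length v}"
    unfolding set_positions by (auto, metis row_label.exhaust)
  moreover have "distinct (positions R1 v @ positions R2 v @ positions R3 v)"
    using positions_disjoint[of R1 R2 v] positions_disjoint[of R1 R3 v]
      positions_disjoint[of R2 R3 v]
    by (auto simp: distinct_positions)
  ultimately show ?thesis
    using assms unfolding tableau_of_def of_rows_in_SYT_le3_iff of_rows_in_SYT_iff yamanouchi_def
    by (auto simp: ballot_iff_positions sorted_positions)
qed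

lemma tableau_of_inject:
  assumes "tableau_of v = tableau_of w" and "length v = length w"
  shows "v = w"
proof (rule positions_inject[OF assms(2)])
  fix x
  show "set (positions x v) = set (positions x w)"
    using assms(1) row_of_rows unfolding tableau_of_def by (cases x) metis+
qed

lemma tableau_of_surj:
  assumes "T \<in> SYT_le3 n"
  shows "\<exists>v. yamanouchi v \<and> length v = n \<and> tableau_of v = T"
proof -
  define a b c where abc: "a = row T 1" "b = row T 2" "c = row T 3"
  have T: "T = of_rows [a, b, c]" using SYT_le3_of_rows[OF assms] abc by simp
  then have *: "length c \<le> length b" "length b \<le> length a" "distinct (a @ b @ c)"
    "set (a @ b @ c) = {1..n}" "sorted_wrt (<) a" "sorted_wrt (<) b" "sorted_wrt (<) c"
    "\<forall>j < length b. a ! j < b ! j" "\<forall>j < length c. b ! j < c ! j"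
    using assms of_rows_in_SYT_le3_iff of_rows_in_SYT_iff by metis+
  have mem: "k \<in> {1..n} \<longleftrightarrow> k \<in> set a \<or> k \<in> set b \<or> k \<in> set c" for k
    unfolding *(4)[symmetric] by simp
  have disj: "set a \<inter> set b = {}" "set a \<inter> set c = {}" "set b \<inter> set c = {}"
    using *(3) by auto
  define f where "f k = (if k \<in> set a then R1 else if k \<in> set b then R2 else R3)" for k
  define v where "v = map f (rev [1..<Suc n])"
  have eq: "positions x v = r"
    if "sorted_wrt (<) r" "set r = {k \<in> {1..n}. f k = x}" for x r
    unfolding v_def positions_map_rev_upt
  proof (rule strict_sorted_equal[OF that(1) sorted_wrt_filter[OF sorted_wrt_upt]])
    show "set (filter (\<lambda>k. f k = x) [1..<Suc n]) = set r"
      unfolding that(2) by auto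
  qed
  have "positions R1 v = a"
    by (rule eq[OF *(5)]) (auto simp: mem f_def simp del: atLeastAtMost_iff One_nat_def)
  moreover have "positions R2 v = b"
    by (rule eq[OF *(6)]) (use disj in \<open>auto simp: mem f_def simp del: atLeastAtMost_iff One_nat_def\<close>)
  moreover have "positions R3 v = c"
    by (rule eq[OF *(7)]) (use disj in \<open>auto simp: mem f_def simp del: atLeastAtMost_iff One_nat_def\<close>)
  ultimately have "tableau_of v = T" "yamanouchi v"
    using * T length_positions[of R1 v] length_positions[of R2 v] length_positions[of R3 v]
    by (auto simp: tableau_of_def yamanouchi_def ballot_iff_positions)
  then show ?thesis using v_def by auto
qed

lemma cong_2_iff: "[a = b] (mod 2) \<longleftrightarrow> even (a + b)" for a b :: nat
  unfolding cong_def by presburger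

lemma equal_parity_tableau_of:
  "equal_parity (tableau_of v) \<longleftrightarrow>
     even (count_list v R1 + count_list v R2) \<and> even (count_list v R1 + count_list v R3)"
  unfolding equal_parity_def tableau_of_def row_of_rows cong_2_iff length_positions
  by presburger

lemma defective_tableau_of:
  "defective (tableau_of v) 2 \<longleftrightarrow> count_list v R2 > 0 \<and> odd (count_list v R1 + count_list v R3)"
  "defective (tableau_of v) 3 \<longleftrightarrow> count_list v R3 > 0 \<and> odd (count_list v R1 + count_list v R2)"
  unfolding defective_def tableau_of_def row_of_rows cells_of_rows cong_2_iff positions_eq_Nil
    length_positions
  by auto

lemma move_M2_tableau_of:
  "move_M2 (tableau_of (replicate i R3 @ R2 # t)) = tableau_of (replicate i R3 @ R1 # t)"
  by (simp add: move_M2_def tableau_of_def row_of_rows positions_append positions_replicate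
      del: One_nat_def)

text \<open>
  In a word of this form the last entry of row 3 is the last letter of the run of \<open>R3\<close>, and the
  largest smaller entry of row 2 is the \<open>R2\<close> directly below that run in value. So the move turns this
  \<open>R2\<close> into \<open>R1\<close> and that \<open>R3\<close> into \<open>R2\<close>.
\<close>

lemma move_M1_tableau_of:
  "move_M1 (tableau_of (replicate j R2 @ replicate (Suc i) R3 @ R2 # t)) =
   tableau_of (replicate (Suc j) R2 @ replicate i R3 @ R1 # t)"
proof -
  define N where "N = length t"
  define v where "v = replicate j R2 @ replicate (Suc i) R3 @ R2 # t"
  define s where "s = replicate (Suc j) R2 @ replicate i R3 @ R1 # t"
  define y where "y = N + i + 2"
  define later where "later = map (\<lambda>k. k + y) [1..<Suc j]"
  have r1: "positions R1 v = positions R1 t" "positions R1 s = positions R1 t @ [Suc N]"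
    by (simp_all add: v_def s_def N_def positions_append positions_replicate)
  have r2: "positions R2 v = positions R2 t @ [Suc N] @ later"
    by (simp add: v_def N_def y_def later_def positions_append positions_replicate del: upt_Suc replicate_Suc)
  have "[1..<Suc (Suc j)] = 1 # map Suc [1..<Suc j]"
    by (simp add: map_Suc_upt upt_conv_Cons del: upt_Suc)
  then have r2s: "positions R2 s = positions R2 t @ [y] @ later"
    by (simp add: s_def N_def y_def later_def positions_append positions_replicate
        del: upt_Suc replicate_Suc)
  have r3: "positions R3 v = positions R3 s @ [y]"
    by (simp add: v_def s_def N_def y_def positions_append positions_replicate)
  have small: "k \<in> set (positions R2 t) \<Longrightarrow> k \<le> N" for k
    using positions_le N_def by metis
  have large: "k \<in> set later \<Longrightarrow> k > y" for k
    by (auto simp: later_def)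
  have "Max {z \<in> set (positions R2 v). z < y} = Suc N"
  proof (rule Max_eqI)
    show "z \<le> Suc N" if "z \<in> {z \<in> set (positions R2 v). z < y}" for z
      using that small[of z] large[of z] by (auto simp: r2)
  qed (auto simp: r2 y_def)
  moreover have "map (\<lambda>z. if z = Suc N then y else z) (positions R2 v) = positions R2 s"
  proof -
    have "map (\<lambda>z. if z = Suc N then y else z) (positions R2 t) = positions R2 t"
      using small[of "Suc N"] by (intro map_idI) auto
    moreover have "map (\<lambda>z. if z = Suc N then y else z) later = later"
      using large[of "Suc N"] by (intro map_idI) (auto simp: y_def)
    ultimately show ?thesis by (simp add: r2 r2s)
  qed
  ultimately have "move_M1 (tableau_of v) = tableau_of s"
    by (simp add: move_M1_def tableau_of_def row_of_rows r3 r1 Let_def del: One_nat_def)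
  then show ?thesis by (simp add: v_def s_def)
qed

section \<open>The parity correction on words\<close>

text \<open>
  The words of the tableaux $P(\theta(\pi))$ with $\pi \in \mathfrak{R}_n$, by \<open>run_reachable\<close> and
  \<open>reachable_run\<close>.
\<close>

definition reachable :: "row_label list \<Rightarrow> bool" where
  "reachable v \<longleftrightarrow> yamanouchi v \<and> (count_list v R1 = count_list v R2 \<or> pair23 0 v)"

lemma pair23_replicate_R3 [simp]: "pair23 q (replicate i R3 @ v) = pair23 (q + i) v"
  by (induction i arbitrary: q) auto

lemma pair23_replicate_R2 [simp]: "pair23 0 (replicate j R2 @ v) = pair23 0 v"
  by (induction j) auto

lemma pair23_pos: "q > 0 \<Longrightarrow> pair23 q v \<Longrightarrow> \<exists>i t. v = replicate i R3 @ R2 # t"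
proof (induction q v rule: pair23.induct)
  case (3 q v)
  have "R2 # v = replicate 0 R3 @ R2 # v" by simp
  then show ?case by blast
next
  case (4 q v)
  then obtain i t where "v = replicate i R3 @ R2 # t" by auto
  then have "R3 # v = replicate (Suc i) R3 @ R2 # t" by simp
  then show ?case by blast
qed auto

lemma pair23_decompose:
  "pair23 0 v \<Longrightarrow> \<exists>j i t. v = replicate j R2 @ replicate (Suc i) R3 @ R2 # t"
proof (induction v)
  case (Cons x v)
  show ?case
  proof (cases x)
    case R2
    then obtain j i t where "v = replicate j R2 @ replicate (Suc i) R3 @ R2 # t"
      using Cons by auto
    then have "x # v = replicate (Suc j) R2 @ replicate (Suc i) R3 @ R2 # t"
      using R2 by simp
    then show ?thesis by blast
  next
    case R3
    then obtain i t where "v = replicate i R3 @ R2 # t"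
      using Cons.prems pair23_pos[of 1 v] by auto
    then have "x # v = replicate 0 R2 @ replicate (Suc i) R3 @ R2 # t"
      using R3 by simp
    then show ?thesis by blast
  qed (use Cons.prems in simp)
qed simp

lemma not_pair23_pos:
  "q > 0 \<Longrightarrow> \<not> pair23 q v \<Longrightarrow> R1 \<in> set v \<Longrightarrow> \<exists>i t. v = replicate i R3 @ R1 # t"
proof (induction q v rule: pair23.induct)
  case (2 q v)
  have "R1 # v = replicate 0 R3 @ R1 # v" by simp
  then show ?case by blast
next
  case (4 q v)
  then obtain i t where "v = replicate i R3 @ R1 # t" by auto
  then have "R3 # v = replicate (Suc i) R3 @ R1 # t" by simp
  then show ?case by blast
qed auto

lemma not_pair23_decompose:
  "\<not> pair23 0 v \<Longrightarrow> R1 \<in> set v \<Longrightarrow> \<exists>j i t. v = replicate j R2 @ replicate i R3 @ R1 # t"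
proof (induction v)
  case (Cons x v)
  show ?case
  proof (cases x)
    case R1
    then have "x # v = replicate 0 R2 @ replicate 0 R3 @ R1 # v" by simp
    then show ?thesis by blast
  next
    case R2
    then obtain j i t where "v = replicate j R2 @ replicate i R3 @ R1 # t"
      using Cons by auto
    then have "x # v = replicate (Suc j) R2 @ replicate i R3 @ R1 # t"
      using R2 by simp
    then show ?thesis by blast
  next
    case R3
    then obtain i t where "v = replicate i R3 @ R1 # t"
      using Cons.prems not_pair23_pos[of 1 v] by auto
    then have "x # v = replicate 0 R2 @ replicate (Suc i) R3 @ R1 # t"
      using R3 by simp
    then show ?thesis by blast
  qed
qed simp

lemma replicate_append_inject:
  assumes "replicate i x @ y # t = replicate i' x @ y # t'" and "x \<noteq> y"
  shows "i = i' \<and> t = t'"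
  using assms(1)
proof (induction i arbitrary: i')
  case 0
  then show ?case using assms(2) by (cases i') auto
next
  case (Suc i)
  then show ?case using assms(2) by (cases i') auto
qed

text \<open>
  Every corrected word that differs from its source has an end of this form, possibly below one
  more \<open>R1\<close>, so unique parsing identifies the source.
\<close>

lemma decompose_inject:
  assumes "replicate j R2 @ replicate i R3 @ R1 # t = replicate j' R2 @ replicate i' R3 @ R1 # t'"
  shows "j = j' \<and> i = i' \<and> t = t'"
  using assms
proof (induction j arbitrary: j')
  case 0
  then show ?case using replicate_append_inject[of i R3 R1 t i' t'] by (cases j'; cases i) auto
next
  case (Suc j)
  from Suc.prems have "j' \<noteq> 0" by (cases j'; cases i') auto
  then obtain k where "j' = Suc k" using not0_implies_Suc by blast
  then show ?case using Suc.IH[of k] Suc.prems by simp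
qed

text \<open>
  The effect of the parity correction on the word of a tableau, with one rule for each set of moves
  that is carried out. Both parity conditions compare a row length with the number of cells, as the sum of
  the other two row lengths is even exactly when the length of the row has the parity of that number.
\<close>

inductive corrects :: "row_label list \<Rightarrow> row_label list \<Rightarrow> bool" where
  unchanged: "even (count_list v R1 + count_list v R2) \<Longrightarrow> even (count_list v R1 + count_list v R3)
    \<Longrightarrow> corrects v v"
| by_M1: "v = replicate j R2 @ replicate (Suc i) R3 @ R2 # t
    \<Longrightarrow> odd (count_list v R1 + count_list v R2) \<Longrightarrow> even (count_list v R1 + count_list v R3)
    \<Longrightarrow> corrects v (replicate (Suc j) R2 @ replicate i R3 @ R1 # t)"
| by_M2: "v = replicate i R3 @ R2 # t
    \<Longrightarrow> even (count_list v R1 + count_list v R2) \<Longrightarrow> odd (count_list v R1 + count_list v R3)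
    \<Longrightarrow> corrects v (replicate i R3 @ R1 # t)"
| by_both: "v = replicate j R2 @ replicate (Suc i) R3 @ R2 # t
    \<Longrightarrow> odd (count_list v R1 + count_list v R2) \<Longrightarrow> odd (count_list v R1 + count_list v R3)
    \<Longrightarrow> corrects v (R1 # replicate j R2 @ replicate i R3 @ R1 # t)"

lemmas word_simps = ballot_replicate_append count_list_append count_list_replicate yamanouchi_def

lemma corrects_length: "corrects v s \<Longrightarrow> length s = length v"
  by (induction rule: corrects.induct) auto

text \<open>
  Only the move \<open>M2\<close> alone can endanger an inequality, namely the one between rows 2 and 3. These rows
  then have different parity, so row 2 is strictly longer.
\<close>

lemma corrects_yamanouchi:
  assumes "corrects v s" and "reachable v"
  shows "yamanouchi s"
  using assms
proof (induction rule: corrects.induct)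
  case (by_M2 v i t)
  have "count_list v R3 \<noteq> count_list v R2"
  proof
    assume "count_list v R3 = count_list v R2"
    with by_M2(2,3) show False by simp
  qed
  then show ?case using by_M2(1,4) by (auto simp: word_simps reachable_def)
qed (simp_all add: word_simps reachable_def)

lemma corrects_even:
  assumes "corrects v s"
  shows "even (count_list s R1 + count_list s R2) \<and> even (count_list s R1 + count_list s R3)"
  using assms by (induction rule: corrects.induct) (auto simp: word_simps)

text \<open>
  If \<open>pair23 0 v\<close> fails, then rows 1 and 2 have the same length, so row 3 is not defective. If row 2 is,
  the last letter other than \<open>R3\<close> must be \<open>R2\<close>: an \<open>R1\<close> there would leave row 1 shorter than row 2
  just before.
\<close>

lemma corrects_exists:
  assumes "reachable v"
  shows "\<exists>s. corrects v s"
proof (cases "pair23 0 v")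
  case True
  then obtain j i t where v: "v = replicate j R2 @ replicate (Suc i) R3 @ R2 # t"
    using pair23_decompose by blast
  have "\<exists>i' t'. v = replicate i' R3 @ R2 # t'"
  proof (cases j)
    case 0
    then show ?thesis using v by (intro exI[of _ "Suc i"] exI[of _ t]) simp
  next
    case (Suc j')
    then show ?thesis using v by (intro exI[of _ 0]) simp
  qed
  then show ?thesis
    using corrects.unchanged[of v] corrects.by_M1[OF v] corrects.by_M2[of v] corrects.by_both[OF v]
    by blast
next
  case False
  then have eq: "count_list v R1 = count_list v R2" and yam: "yamanouchi v"
    using assms by (auto simp: reachable_def)
  have "\<exists>i t. v = replicate i R3 @ R2 # t" if odd: "odd (count_list v R1 + count_list v R3)"
  proof -
    have "\<exists>i t. v = replicate i R3 \<or> v = replicate i R3 @ R1 # t \<or> v = replicate i R3 @ R2 # t"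
      for v :: "row_label list"
    proof (induction v)
      case (Cons x v)
      then obtain i t where
        "v = replicate i R3 \<or> v = replicate i R3 @ R1 # t \<or> v = replicate i R3 @ R2 # t" by blast
      moreover have "R3 # replicate i R3 = replicate (Suc i) R3" by simp
      moreover have "x # v = replicate 0 R3 @ x # v" by simp
      ultimately show ?case by (cases x) (metis append_Cons)+
    qed simp
    then obtain i t where
      "v = replicate i R3 \<or> v = replicate i R3 @ R1 # t \<or> v = replicate i R3 @ R2 # t" by blast
    moreover have "v \<noteq> replicate i R3"
      using yam odd by (auto simp: count_list_replicate yamanouchi_def dest: ballot_count)
    moreover have "v \<noteq> replicate i R3 @ R1 # t"
      using yam eq ballot_count[of R1 R2 t] by (auto simp: word_simps)
    ultimately show ?thesis by blast
  qed
  then show ?thesis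
    using eq corrects.unchanged[of v] corrects.by_M2[of v]
    by (cases "even (count_list v R1 + count_list v R3)") (fastforce, metis even_add)
qed

text \<open>
  A defective row is nonempty by definition. The words in \<open>corrects\<close> contain the letter of each row that
  is moved, so comparing parities is enough.
\<close>

lemma Psi_tableau_of:
  assumes "corrects v s" and "reachable v"
  shows "Psi (tableau_of v) = tableau_of s"
  using assms
proof (induction rule: corrects.induct)
  case (unchanged v)
  then show ?case by (simp add: Psi_def Let_def defective_tableau_of)
next
  case (by_M1 v j i t)
  define s where "s = replicate (Suc j) R2 @ replicate i R3 @ R1 # t"
  have "defective (tableau_of v) 3" "\<not> defective (tableau_of s) 2"
    using by_M1 by (auto simp: defective_tableau_of word_simps s_def)
  then show ?case
    using move_M1_tableau_of[of j i t] by_M1(1) by (simp add: Psi_def Let_def s_def)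
next
  case (by_M2 v i t)
  have "\<not> defective (tableau_of v) 3" "defective (tableau_of v) 2"
    using by_M2 by (auto simp: defective_tableau_of word_simps)
  then show ?case
    using move_M2_tableau_of[of i t] by_M2(1) by (simp add: Psi_def Let_def)
next
  case (by_both v j i t)
  define s where "s = replicate (Suc j) R2 @ replicate i R3 @ R1 # t"
  have "defective (tableau_of v) 3" "defective (tableau_of s) 2"
    using by_both by (auto simp: defective_tableau_of word_simps s_def)
  then show ?case
    using move_M1_tableau_of[of j i t] by_both(1)
      move_M2_tableau_of[of 0 "replicate j R2 @ replicate i R3 @ R1 # t"]
    by (simp add: Psi_def Let_def s_def)
qed

text \<open>
  If \<open>s\<close> is not reachable, its end has the form \<open>R2\<^sup>j R3\<^sup>i R1\<close> in backward reading, and row 1 is longer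
  than row 2 by at least 2. The exponents tell which moves were made: $j > 0$ means \<open>M1\<close>, and $j = 0$
  with $i > 0$ means \<open>M2\<close>. For $i = j = 0$, undoing \<open>M2\<close> at the last letter gives a reachable word unless
  the gap is at least 4 and \<open>pair23\<close> fails below that letter, and exactly then both moves are undone.
\<close>

lemma corrects_surj:
  assumes "yamanouchi s"
    and "even (count_list s R1 + count_list s R2)" and "even (count_list s R1 + count_list s R3)"
  shows "\<exists>v. reachable v \<and> corrects v s"
proof (cases "reachable s")
  case True
  then show ?thesis using assms corrects.unchanged by blast
next
  case False
  with assms(1) have np: "\<not> pair23 0 s" and "count_list s R1 \<noteq> count_list s R2"
    by (auto simp: reachable_def)
  moreover have "count_list s R2 \<le> count_list s R1"
    using assms(1) by (auto simp: yamanouchi_def dest: ballot_count)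
  ultimately have gap: "count_list s R2 + 2 \<le> count_list s R1"
    using assms(2) by presburger
  then have "R1 \<in> set s" by (metis count_notin le_zero_eq add_is_0 zero_neq_numeral)
  then obtain j i t where s: "s = replicate j R2 @ replicate i R3 @ R1 # t"
    using not_pair23_decompose np by blast
  note * = assms gap
  \<comment> \<open>The source was changed by \<open>M1\<close>, by \<open>M2\<close>, and by \<open>M2\<close> or both moves, respectively.\<close>
  consider j' where "j = Suc j'" | "j = 0" "i > 0" | "j = 0" "i = 0" by (cases j) auto
  then show ?thesis
  proof cases
    case 1
    define v where "v = replicate j' R2 @ replicate (Suc i) R3 @ R2 # t"
    have "reachable v" using * s 1 by (auto simp: reachable_def v_def word_simps)
    moreover have "corrects v s"
      using * corrects.by_M1[OF v_def] s 1 by (auto simp: v_def word_simps)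
    ultimately show ?thesis by blast
  next
    case 2
    define v where "v = replicate i R3 @ R2 # t"
    have "reachable v" using * s 2 by (auto simp: reachable_def v_def word_simps)
    moreover have "corrects v s"
      using * corrects.by_M2[OF v_def] s 2 by (auto simp: v_def word_simps)
    ultimately show ?thesis by blast
  next
    case 3
    then have s: "s = R1 # t" using s by simp
    show ?thesis
    proof (cases "pair23 0 t \<or> count_list s R1 = count_list s R2 + 2")
      case True
      define v where "v = replicate 0 R3 @ R2 # t"
      have "reachable v" using * s True by (auto simp: reachable_def v_def word_simps)
      moreover have "corrects v s"
        using * corrects.by_M2[OF v_def] s by (auto simp: v_def word_simps)
      ultimately show ?thesis by blast
    next
      case False
      then have gap: "count_list s R2 + 3 \<le> count_list s R1" using gap by simp
      then have "R1 \<in> set t" using s by (auto intro: ccontr simp: count_notin)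
      then obtain j i t' where t: "t = replicate j R2 @ replicate i R3 @ R1 # t'"
        using not_pair23_decompose False by blast
      define v where "v = replicate j R2 @ replicate (Suc i) R3 @ R2 # t'"
      have "reachable v" using * s t gap by (auto simp: reachable_def v_def word_simps)
      moreover have "corrects v s"
        using * corrects.by_both[OF v_def] s t by (auto simp: v_def word_simps)
      ultimately show ?thesis by blast
    qed
  qed
qed

text \<open>
  A change makes row 1 longer than row 2 and leaves an end on which every \<open>R3\<close> after the last \<open>R1\<close>
  comes before every \<open>R2\<close> in reading order.
\<close>

lemma corrects_changed_unreachable:
  assumes "corrects v s" and "reachable v" and "v \<noteq> s"
  shows "\<not> reachable s"
  using assms(1)
proof cases
  case unchanged
  then show ?thesis using assms by simp
qed (use assms in \<open>auto simp: reachable_def word_simps dest: ballot_count\<close>)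

text \<open>
  The sources of the four kinds are told apart as in \<open>corrects_surj\<close>. The overlap between \<open>M2\<close> alone
  and both moves is excluded because the former needs \<open>pair23\<close> below the last letter or a gap of
  exactly 2 between rows 1 and 2, and the latter has neither.
\<close>

lemma corrects_inject:
  assumes "corrects v s" "corrects v' s" and "reachable v" "reachable v'"
  shows "v = v'"
proof (cases "v = s \<or> v' = s")
  case True
  then show ?thesis using corrects_changed_unreachable assms by metis
next
  case False
  have le: "count_list v R2 \<le> count_list v R1" "count_list v' R2 \<le> count_list v' R1"
    using assms by (auto simp: reachable_def yamanouchi_def dest: ballot_count)
  \<comment> \<open>\<open>M2\<close> alone and both moves never give the same word: their results differ in \<open>pair23\<close> below the
      last letter or in the gap between rows 1 and 2.\<close>
  have M2_both: False
    if "w = replicate i R3 @ R2 # t" "s = replicate i R3 @ R1 # t" "reachable w"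
      "w' = replicate j' R2 @ replicate (Suc i') R3 @ R2 # t'" "count_list w' R2 \<le> count_list w' R1"
      "s = R1 # replicate j' R2 @ replicate i' R3 @ R1 # t'" for w w' i t i' j' t'
  proof -
    have "i = 0" using that(2,6) by (cases i) auto
    then show False using that by (auto simp: reachable_def word_simps)
  qed
  from assms(1) show ?thesis
  proof cases
    case unchanged
    then show ?thesis using False by simp
  next
    case 1: (by_M1 j i t)
    from assms(2) show ?thesis
    proof cases
      case unchanged
      then show ?thesis using False by simp
    next
      case (by_M1 j' i' t')
      then show ?thesis using 1 decompose_inject[of "Suc j" i t "Suc j'" i' t'] by simp
    next
      case (by_M2 i' t')
      then show ?thesis using 1 by (cases i') auto
    next
      case (by_both j' i' t')
      then show ?thesis using 1 by simp
    qed
  next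
    case 1: (by_M2 i t)
    from assms(2) show ?thesis
    proof cases
      case unchanged
      then show ?thesis using False by simp
    next
      case (by_M1 j' i' t')
      then show ?thesis using 1 by (cases i) auto
    next
      case (by_M2 i' t')
      then show ?thesis using 1 replicate_append_inject[of i R3 R1 t i' t'] by simp
    next
      case (by_both j' i' t')
      then show ?thesis using M2_both[OF 1(2,1) assms(3) by_both(2) le(2) by_both(1)] by blast
    qed
  next
    case 1: (by_both j i t)
    from assms(2) show ?thesis
    proof cases
      case unchanged
      then show ?thesis using False by simp
    next
      case (by_M1 j' i' t')
      then show ?thesis using 1 by simp
    next
      case (by_M2 i' t')
      then show ?thesis using M2_both[OF by_M2(2,1) assms(4) 1(2) le(1) 1(1)] by blast
    next
      case (by_both j' i' t')
      then show ?thesis using 1 decompose_inject[of j i t j' i' t'] by simp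
    qed
  qed
qed

section \<open>Permutations as sequences of blocks\<close>

abbreviation one_line :: "nat \<Rightarrow> (nat \<Rightarrow> nat) \<Rightarrow> nat list" where
  "one_line n \<pi> \<equiv> map \<pi> [1..<Suc n]"

lemma upt_split: "j \<le> i \<Longrightarrow> i < k \<Longrightarrow> [j..<k] = [j..<i] @ i # [Suc i..<k]"
  using upt_add_eq_append[of j i "k - i"] by (simp add: upt_conv_Cons)

lemma one_line_eq_split_iff:
  "one_line n \<pi> = p @ a # q \<longleftrightarrow>
   (\<exists>i \<in> {1..n}. p = map \<pi> [1..<i] \<and> a = \<pi> i \<and> q = map \<pi> [Suc i..<Suc n])"
proof
  assume eq: "one_line n \<pi> = p @ a # q"
  define i where "i = Suc (length p)"
  from eq have "length (one_line n \<pi>) = length (p @ a # q)" by (rule arg_cong)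
  then have i: "1 \<le> i" "i \<le> n" by (auto simp: i_def simp del: upt_Suc)
  have "[1..<Suc n] = [1..<i] @ i # [Suc i..<Suc n]"
    using i by (intro upt_split) auto
  then have "map \<pi> [1..<i] @ \<pi> i # map \<pi> [Suc i..<Suc n] = p @ a # q"
    using eq by simp
  moreover have "length (map \<pi> [1..<i]) = length p" by (simp add: i_def del: upt_Suc)
  ultimately show "\<exists>i \<in> {1..n}. p = map \<pi> [1..<i] \<and> a = \<pi> i \<and> q = map \<pi> [Suc i..<Suc n]"
    using i by (intro bexI[of _ i]) (auto simp: append_eq_append_conv simp del: upt_Suc)
next
  assume "\<exists>i \<in> {1..n}. p = map \<pi> [1..<i] \<and> a = \<pi> i \<and> q = map \<pi> [Suc i..<Suc n]"
  then obtain i where i: "1 \<le> i" "i \<le> n" "p = map \<pi> [1..<i]" "a = \<pi> i"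
    "q = map \<pi> [Suc i..<Suc n]" by auto
  have "[1..<Suc n] = [1..<i] @ i # [Suc i..<Suc n]"
    using i by (intro upt_split) auto
  then show "one_line n \<pi> = p @ a # q" using i by simp
qed

lemma exists_one_line:
  assumes "distinct xs" and "set xs = {1..n}"
  shows "\<exists>\<pi>. \<pi> permutes {1..n} \<and> one_line n \<pi> = xs"
proof -
  have len: "length xs = n"
    using distinct_card[OF assms(1)] assms(2) by simp
  define \<pi> where "\<pi> i = (if i \<in> {1..n} then xs ! (i - 1) else i)" for i
  have eq: "one_line n \<pi> = xs"
    by (rule nth_equalityI) (auto simp: \<pi>_def len simp del: upt_Suc)
  have "inj_on \<pi> {1..n}"
    using eq assms(1) by (metis atLeastLessThanSuc_atLeastAtMost distinct_map set_upt)
  moreover have "\<pi> ` {1..n} = {1..n}"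
    using eq assms(2) by (metis atLeastLessThanSuc_atLeastAtMost set_map set_upt)
  ultimately have "\<pi> permutes {1..n}"
    by (intro bij_imp_permutes) (auto simp: bij_betw_def \<pi>_def)
  then show ?thesis using eq by blast
qed

lemma one_line_permutes:
  assumes "\<pi> permutes {1..n}"
  shows "distinct (one_line n \<pi>)" and "set (one_line n \<pi>) = {1..n}"
proof -
  show "distinct (one_line n \<pi>)"
    using permutes_inj_on[OF assms] by (simp add: distinct_map del: upt_Suc)
  show "set (one_line n \<pi>) = {1..n}"
    using permutes_image[OF assms] by (metis atLeastLessThanSuc_atLeastAtMost set_map set_upt)
qed

lemma one_line_inject:
  assumes "\<pi> permutes {1..n}" "\<sigma> permutes {1..n}" "one_line n \<pi> = one_line n \<sigma>"
  shows "\<pi> = \<sigma>"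
proof
  fix i
  show "\<pi> i = \<sigma> i"
  proof (cases "i \<in> {1..n}")
    case True
    then have "i \<in> set [1..<Suc n]" by auto
    then show ?thesis using assms(3)[unfolded map_eq_conv] by (rule bspec[rotated])
  next
    case False
    then show ?thesis using assms(1,2) by (simp add: permutes_not_in)
  qed
qed

definition no_321_list :: "nat list \<Rightarrow> bool" where
  "no_321_list xs \<longleftrightarrow> (\<forall>p a q b r c s. xs = p @ a # q @ b # r @ c # s \<longrightarrow> \<not> (a > b \<and> b > c))"

definition maxima_descend :: "nat list \<Rightarrow> bool" where
  "maxima_descend xs \<longleftrightarrow>
     (\<forall>p a q. xs = p @ a # q \<longrightarrow> (\<forall>y \<in> set p. y < a) \<longrightarrow> q \<noteq> [] \<and> hd q < a)"

lemma avoids_321_one_line: "avoids_321 n \<pi> \<longleftrightarrow> no_321_list (one_line n \<pi>)"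
proof
  assume av: "avoids_321 n \<pi>"
  show "no_321_list (one_line n \<pi>)"
    unfolding no_321_list_def
  proof (intro allI impI)
    fix p a q b r c s
    assume eq: "one_line n \<pi> = p @ a # q @ b # r @ c # s"
    from eq obtain i where i: "i \<in> {1..n}" "p = map \<pi> [1..<i]" "a = \<pi> i"
      using one_line_eq_split_iff by blast
    from eq have "one_line n \<pi> = (p @ a # q) @ b # (r @ c # s)" by simp
    then obtain j where j: "j \<in> {1..n}" "p @ a # q = map \<pi> [1..<j]" "b = \<pi> j"
      using one_line_eq_split_iff by blast
    from eq have "one_line n \<pi> = (p @ a # q @ b # r) @ c # s" by simp
    then obtain k where k: "k \<in> {1..n}" "p @ a # q @ b # r = map \<pi> [1..<k]" "c = \<pi> k"
      using one_line_eq_split_iff by blast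
    have "length p = i - 1" by (simp add: i(2))
    moreover have "length (p @ a # q) = j - 1" by (simp only: j(2) length_map length_upt)
    moreover have "length (p @ a # q @ b # r) = k - 1" by (simp only: k(2) length_map length_upt)
    ultimately have "i < j" "j < k" by auto
    then show "\<not> (a > b \<and> b > c)"
      using av i j k unfolding avoids_321_def by auto
  qed
next
  assume no: "no_321_list (one_line n \<pi>)"
  show "avoids_321 n \<pi>"
    unfolding avoids_321_def
  proof
    assume "\<exists>i j k. 1 \<le> i \<and> i < j \<and> j < k \<and> k \<le> n \<and> \<pi> i > \<pi> j \<and> \<pi> j > \<pi> k"
    then obtain i j k where ijk: "1 \<le> i" "i < j" "j < k" "k \<le> n" "\<pi> i > \<pi> j" "\<pi> j > \<pi> k"
      by blast
    have "[1..<Suc n] = [1..<i] @ i # [Suc i..<j] @ j # [Suc j..<k] @ k # [Suc k..<Suc n]"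
      using ijk upt_split[of 1 i "Suc n"] upt_split[of "Suc i" j "Suc n"]
        upt_split[of "Suc j" k "Suc n"] by simp
    then have "one_line n \<pi> = map \<pi> [1..<i] @ \<pi> i # map \<pi> [Suc i..<j] @ \<pi> j #
        map \<pi> [Suc j..<k] @ \<pi> k # map \<pi> [Suc k..<Suc n]" by simp
    then show False using no ijk unfolding no_321_list_def by blast
  qed
qed

lemma LR_positions_descend_iff:
  "(\<forall>i \<in> LR_positions n \<pi>. i < n \<and> \<pi> i > \<pi> (i + 1)) \<longleftrightarrow> maxima_descend (one_line n \<pi>)"
proof -
  have hd: "map \<pi> [Suc i..<Suc n] \<noteq> [] \<and> hd (map \<pi> [Suc i..<Suc n]) < \<pi> i
      \<longleftrightarrow> i < n \<and> \<pi> i > \<pi> (i + 1)" for i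
    by (auto simp: upt_conv_Cons simp del: upt_Suc)
  have "maxima_descend (one_line n \<pi>) \<longleftrightarrow>
    (\<forall>i \<in> {1..n}. (\<forall>y \<in> set (map \<pi> [1..<i]). y < \<pi> i) \<longrightarrow>
       map \<pi> [Suc i..<Suc n] \<noteq> [] \<and> hd (map \<pi> [Suc i..<Suc n]) < \<pi> i)"
    unfolding maxima_descend_def one_line_eq_split_iff by blast
  then show ?thesis unfolding hd LR_positions_def by auto
qed

lemma LR_one_line:
  "LR n \<pi> = {a. \<exists>p q. one_line n \<pi> = p @ a # q \<and> (\<forall>y \<in> set p. y < a)}"
proof -
  have "LR n \<pi> = {a. \<exists>i \<in> {1..n}. a = \<pi> i \<and> (\<forall>y \<in> set (map \<pi> [1..<i]). y < a)}"
    unfolding LR_def LR_positions_def by auto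
  also have "\<dots> = {a. \<exists>p q. one_line n \<pi> = p @ a # q \<and> (\<forall>y \<in> set p. y < a)}"
    unfolding one_line_eq_split_iff by blast
  finally show ?thesis .
qed

text \<open>
  A permutation is cut in front of each left-to-right maximum; a block is such a maximum with the list
  of entries up to the next one.
\<close>

type_synonym blocks = "(nat \<times> nat list) list"

definition block_word :: "blocks \<Rightarrow> nat list" where
  "block_word bs = concat (map (\<lambda>(m, xs). m # xs) bs)"

text \<open>
  The normal form of the permutations in $\mathfrak{R}_n$: descents at the maxima make the
  blocks nontrivial, and avoiding 321 makes the entries other than maxima increase. In each block the
  last entry is then the largest one, namely $a_j$.
\<close>

definition block_form :: "blocks \<Rightarrow> bool" where
  "block_form bs \<longleftrightarrow> sorted_wrt (<) (map fst bs) \<and> sorted_wrt (<) (concat (map snd bs)) \<and>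
     (\<forall>(m, xs) \<in> set bs. xs \<noteq> [] \<and> last xs < m)"

lemma block_word_simps [simp]:
  "block_word [] = []" "block_word ((m, xs) # bs) = m # xs @ block_word bs"
  "block_word (bs @ cs) = block_word bs @ block_word cs"
  by (simp_all add: block_word_def)

lemma block_form_Nil [simp]: "block_form []"
  by (simp add: block_form_def)

lemma block_form_Cons [simp]:
  "block_form ((m, xs) # bs) \<longleftrightarrow> block_form bs \<and> xs \<noteq> [] \<and> last xs < m \<and> sorted_wrt (<) xs \<and>
     (\<forall>l \<in> fst ` set bs. m < l) \<and> (\<forall>x \<in> set xs. \<forall>y \<in> set (concat (map snd bs)). x < y)"
  by (auto simp: block_form_def sorted_wrt_append)

lemma set_block_word: "set (block_word bs) = fst ` set bs \<union> set (concat (map snd bs))"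
proof (induction bs)
  case (Cons b bs)
  then show ?case by (cases b) (simp del: set_concat, blast)
qed simp

lemma length_block_word: "length (block_word bs) = length bs + length (concat (map snd bs))"
  by (induction bs) auto

lemma distinct_block_word_disjoint:
  "distinct (block_word bs) \<Longrightarrow> fst ` set bs \<inter> set (concat (map snd bs)) = {}"
proof (induction bs)
  case (Cons b bs)
  obtain m xs where b: "b = (m, xs)" by fastforce
  have "fst ` set bs \<inter> set (concat (map snd bs)) = {}" using Cons b by simp
  moreover have "m \<notin> set xs" "m \<notin> set (block_word bs)" "set xs \<inter> set (block_word bs) = {}"
    using Cons.prems b by auto
  ultimately show ?case unfolding b set_block_word by auto
qed simp

lemma sorted_le_last: "sorted_wrt (<) xs \<Longrightarrow> x \<in> set xs \<Longrightarrow> x \<le> last xs" for x :: nat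
  by (induction xs) (auto simp: less_imp_le)

lemma sorted_wrt_if_split:
  "(\<And>p a q b r. xs = p @ a # q @ b # r \<Longrightarrow> P a b) \<Longrightarrow> sorted_wrt P xs"
proof (induction xs)
  case (Cons x xs)
  have "P x b" if "b \<in> set xs" for b
    using split_list[OF that] Cons.prems[of "[]" x] by auto
  moreover have "sorted_wrt P xs"
  proof (rule Cons.IH)
    fix p a q b r
    assume "xs = p @ a # q @ b # r"
    then show "P a b" using Cons.prems[of "x # p" a q b r] by simp
  qed
  ultimately show ?case by simp
qed simp

text \<open>
  The first block consists of the first entry \<open>m\<close> and the following entries below \<open>m\<close>. A descent among
  later entries whose upper end is below \<open>m\<close> would complete a 321 pattern with \<open>m\<close>, so the
  entries of the first block increase and lie below all later entries. The rest begins with an entry above everything before it, so its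
  left-to-right maxima are maxima of the whole word and the hypotheses are inherited.
\<close>

lemma exists_block_form:
  assumes "distinct xs" "no_321_list xs" "maxima_descend xs"
  shows "\<exists>bs. block_form bs \<and> xs = block_word bs"
  using assms
proof (induction xs rule: length_induct)
  case (1 xs)
  show ?case
  proof (cases xs)
    case Nil
    then show ?thesis by (intro exI[of _ "[]"]) simp
  next
    case (Cons m ys)
    define N where "N = takeWhile (\<lambda>y. y < m) ys"
    define rest where "rest = dropWhile (\<lambda>y. y < m) ys"
    have xs: "xs = m # N @ rest" by (simp add: Cons N_def rest_def)
    have N_less: "y < m" if "y \<in> set N" for y
      using that set_takeWhileD unfolding N_def by fastforce
    have no: "\<not> (a > b \<and> b > c)" if "xs = p @ a # q @ b # r @ c # s" for p a q b r c s
      using 1(3) that unfolding no_321_list_def by blast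
    have "ys \<noteq> [] \<and> hd ys < m"
      using 1(4) Cons unfolding maxima_descend_def by (metis append_Nil empty_iff empty_set)
    then have "N \<noteq> []" by (cases ys) (auto simp: N_def)
    have hd_rest: "m < hd rest" if "rest \<noteq> []"
    proof -
      have "\<not> hd rest < m" using that hd_dropWhile unfolding rest_def by blast
      moreover have "hd rest \<noteq> m" using 1(2) that xs by (cases rest) auto
      ultimately show ?thesis by simp
    qed
    have "no_321_list rest"
      unfolding no_321_list_def
    proof (intro allI impI)
      fix p a q b r c s
      assume "rest = p @ a # q @ b # r @ c # s"
      then show "\<not> (a > b \<and> b > c)" using no[of "m # N @ p" a q b r c s] xs by simp
    qed
    moreover have "maxima_descend rest"
      unfolding maxima_descend_def
    proof (intro allI impI)
      fix p a q
      assume eq: "rest = p @ a # q" and less: "\<forall>y \<in> set p. y < a"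
      have "m < a" using hd_rest eq less by (cases p) auto
      then have "\<forall>y \<in> set (m # N @ p). y < a" using less N_less by force
      moreover have "xs = (m # N @ p) @ a # q" using xs eq by simp
      ultimately show "q \<noteq> [] \<and> hd q < a"
        using 1(4) unfolding maxima_descend_def by blast
    qed
    moreover have "length rest < length xs" "distinct rest" using xs 1(2) by auto
    ultimately obtain bs where bs: "block_form bs" "rest = block_word bs"
      using 1(1) by blast
    \<comment> \<open>An entry below \<open>m\<close> is smaller than everything after it, as \<open>m\<close> itself stands in front.\<close>
    have less_if: "x < y" if "xs = p @ x # q @ y # r" "x < m" "p \<noteq> []" for x y p q r
    proof -
      from that(1,3) xs obtain p' where "p = m # p'" by (cases p) auto
      then have "\<not> (m > x \<and> x > y)" using no[of "[]" m p' x q y r] that by simp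
      moreover have "x \<noteq> y" using 1(2) that(1) by auto
      ultimately show ?thesis using that(2) by simp
    qed
    have "sorted_wrt (<) N"
    proof (rule sorted_wrt_if_split)
      fix p a q b r
      assume "N = p @ a # q @ b # r"
      then show "a < b" using less_if[of "m # p" a q b "r @ rest"] xs N_less by simp
    qed
    moreover have "x < y" if "x \<in> set N" "y \<in> set (concat (map snd bs))" for x y
    proof -
      have "y \<in> set rest" using that(2) bs by (simp add: set_block_word)
      from split_list[OF this] obtain r s where "rest = r @ y # s" by blast
      moreover from split_list[OF that(1)] obtain p q where "N = p @ x # q" by blast
      ultimately show ?thesis using less_if[of "m # p" x "q @ r" y s] xs N_less[OF that(1)] by simp
    qed
    moreover have "m < l" if "l \<in> fst ` set bs" for l
    proof -
      from that obtain l0 N0 cs where c: "bs = (l0, N0) # cs" by (cases bs) auto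
      then have "m < l0" using hd_rest bs(2) by simp
      then show ?thesis using that bs(1) c by auto
    qed
    ultimately have "block_form ((m, N) # bs)"
      using bs(1) \<open>N \<noteq> []\<close> N_less by auto
    moreover have "xs = block_word ((m, N) # bs)" using xs bs by simp
    ultimately show ?thesis by blast
  qed
qed

text \<open>
  An entry is either a left-to-right maximum followed by a descent, or it has a larger entry before it
  and only larger entries after it. This dichotomy implies avoidance of 321, the descents at the maxima
  and the absence of fixed points.
\<close>

lemma block_word_split:
  assumes "block_form bs" and "block_word bs = p @ a # q"
  shows "a \<in> fst ` set bs \<and> (\<forall>y \<in> set p. y < a) \<and> q \<noteq> [] \<and> hd q < a \<or>
    a \<in> set (concat (map snd bs)) \<and> (\<exists>y \<in> set p. a < y) \<and> (\<forall>y \<in> set q. a < y)"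
  using assms
proof (induction bs arbitrary: p)
  case (Cons b bs)
  obtain m N where b: "b = (m, N)" by fastforce
  note bf = Cons.prems(1)[unfolded b block_form_Cons]
  have N_less: "y < m" if "y \<in> set N" for y
    using sorted_le_last[of N y] that bf by linarith
  show ?case
  proof (cases p)
    case Nil
    then have "a = m" "q = N @ block_word bs" using Cons.prems(2) b by auto
    then show ?thesis using Nil N_less[of "hd N"] bf b by auto
  next
    case (Cons z p')
    then have eq: "z = m" "N @ block_word bs = p' @ a # q" using Cons.prems(2) b by auto
    then consider q' where "N = p' @ a # q'" "q = q' @ block_word bs"
      | p'' where "p' = N @ p''" "block_word bs = p'' @ a # q"
      by (auto simp: append_eq_append_conv2 append_eq_Cons_conv Cons_eq_append_conv)
    then show ?thesis
    proof cases
      case 1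
      have "a < m" using N_less 1 by simp
      moreover have "a < y" if "y \<in> set q" for y
        using that 1 bf \<open>a < m\<close> unfolding 1(2) set_append set_block_word
        by (auto simp: sorted_wrt_append intro: less_trans)
      ultimately show ?thesis using Cons eq 1 b by auto
    next
      case 2
      have "\<forall>y \<in> set (m # N). y < a" if "a \<in> fst ` set bs"
        using that bf N_less by (auto intro: less_trans)
      then show ?thesis using Cons.IH[of p''] 2 bf Cons eq b by auto
    qed
  qed
qed simp

text \<open>
  There are no fixed points by counting: a left-to-right maximum in position \<open>i\<close> exceeds the \<open>i - 1\<close>
  entries before it and the next one, so it is larger than \<open>i\<close>; for any other entry, all smaller values
  and one larger value stand before it, so it is smaller than \<open>i\<close>.
\<close>

lemma block_word_frakR:
  assumes perm: "\<pi> permutes {1..n}" and bs: "block_form bs" and eq: "one_line n \<pi> = block_word bs"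
  shows "\<pi> \<in> frakR n"
proof -
  note split = block_word_split[OF bs]
  have "no_321_list (block_word bs)"
    unfolding no_321_list_def
  proof (intro allI impI notI)
    fix p a q b r c s
    assume eq: "block_word bs = p @ a # q @ b # r @ c # s" and "a > b \<and> b > c"
    from eq have "block_word bs = (p @ a # q) @ b # r @ c # s" by simp
    from split[OF this] show False using \<open>a > b \<and> b > c\<close> by auto
  qed
  moreover have "maxima_descend (block_word bs)"
    unfolding maxima_descend_def
  proof (intro allI impI)
    fix p a q
    assume "block_word bs = p @ a # q" and "\<forall>y \<in> set p. y < a"
    with split[of p a q] show "q \<noteq> [] \<and> hd q < a" by (auto dest: less_asym)
  qed
  moreover have "\<pi> i \<noteq> i" if i: "i \<in> {1..n}" for i
  proof -
    define p q where "p = map \<pi> [1..<i]" "q = map \<pi> [Suc i..<Suc n]"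
    have xs: "one_line n \<pi> = p @ \<pi> i # q"
      using i unfolding one_line_eq_split_iff p_q_def by blast
    have dist: "distinct (p @ \<pi> i # q)" and range: "set (p @ \<pi> i # q) = {1..n}"
      using one_line_permutes[OF perm] unfolding xs by auto
    have len: "length p = i - 1" by (simp add: p_q_def)
    from split[OF xs[unfolded eq]] show ?thesis
    proof
      assume *: "\<pi> i \<in> fst ` set bs \<and> (\<forall>y \<in> set p. y < \<pi> i) \<and> q \<noteq> [] \<and> hd q < \<pi> i"
      then have hd: "hd q \<in> set q" by simp
      have "insert (hd q) (set p) \<subseteq> {1..<\<pi> i}"
        using * hd range by auto
      then have "card (insert (hd q) (set p)) \<le> card {1..<\<pi> i}"
        by (intro card_mono) auto
      moreover have "card (insert (hd q) (set p)) = i"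
        using dist hd i len distinct_card[of p] by (subst card_insert_disjoint) auto
      ultimately show ?thesis using i by auto
    next
      assume *: "\<pi> i \<in> set (concat (map snd bs)) \<and> (\<exists>y \<in> set p. \<pi> i < y) \<and> (\<forall>y \<in> set q. \<pi> i < y)"
      then obtain y where y: "y \<in> set p" "\<pi> i < y" by blast
      have "insert y {1..<\<pi> i} \<subseteq> set p"
      proof
        fix x assume x: "x \<in> insert y {1..<\<pi> i}"
        show "x \<in> set p"
        proof (cases "x = y")
          case False
          then have "1 \<le> x" "x < \<pi> i" using x by auto
          moreover have "\<pi> i \<le> n" using permutes_in_image[OF perm] i by auto
          ultimately have "x \<in> set (p @ \<pi> i # q)" using range by auto
          then show ?thesis using * \<open>x < \<pi> i\<close> by auto
        qed (use y in simp)
      qed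
      then have "card (insert y {1..<\<pi> i}) \<le> card (set p)"
        by (intro card_mono) auto
      moreover have "card (insert y {1..<\<pi> i}) = Suc (\<pi> i - 1)"
        using y by (subst card_insert_disjoint) auto
      moreover have "card (set p) = i - 1"
        using dist len distinct_card[of p] by simp
      ultimately show ?thesis using i by auto
    qed
  qed
  ultimately show ?thesis
    using perm unfolding frakR_def mem_Collect_eq LR_positions_descend_iff avoids_321_one_line eq
    by blast
qed

lemma frakR_block_form:
  assumes "\<pi> \<in> frakR n"
  shows "\<exists>bs. block_form bs \<and> one_line n \<pi> = block_word bs"
  using assms exists_block_form[of "one_line n \<pi>"] one_line_permutes[of \<pi> n]
  unfolding frakR_def mem_Collect_eq LR_positions_descend_iff avoids_321_one_line by blast

section \<open>Step words of permutations\<close>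

lemma sorted_maxima: "block_form bs \<Longrightarrow> sorted_wrt (<) (map fst bs)"
  by (simp add: block_form_def)

lemma blocks_nonempty: "block_form bs \<Longrightarrow> (m, xs) \<in> set bs \<Longrightarrow> xs \<noteq> [] \<and> last xs < m"
  by (auto simp: block_form_def)

lemma sorted_lasts: "block_form bs \<Longrightarrow> sorted_wrt (<) (map (last \<circ> snd) bs)"
proof (induction bs)
  case (Cons b bs)
  obtain m xs where b: "b = (m, xs)" by fastforce
  have "last xs < last (snd c)" if "c \<in> set bs" for c
  proof -
    have "snd c \<noteq> []" using blocks_nonempty[of bs "fst c" "snd c"] Cons.prems that b by simp
    then have "last (snd c) \<in> set (concat (map snd bs))"
      using that by (auto intro!: bexI[of _ c])
    moreover have "last xs \<in> set xs" using Cons.prems b by simp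
    ultimately show ?thesis using Cons.prems unfolding b block_form_Cons by blast
  qed
  then show ?case using Cons b by simp
qed simp

text \<open>
  Each maximum is appended to row 1 and then bumped to the end of row 2 by its partner, so the alternating
  part of $\theta(\pi)$ yields a rectangle with the rows $a_1 \cdots a_k$ and $m_1 \cdots m_k$.
\<close>

lemma fold_row_insert_pairs:
  assumes "sorted_wrt (<) (map fst ps)" and "sorted_wrt (<) (map snd ps)"
    and "\<forall>(m, a) \<in> set ps. a < m" and "ps \<noteq> []"
  shows "fold row_insert (concat (map (\<lambda>(m, a). [m, a]) ps)) [] = [map snd ps, map fst ps]"
  using assms
proof (induction ps rule: rev_induct)
  case (snoc p ps)
  obtain m a where p: "p = (m, a)" by fastforce
  show ?case
  proof (cases "ps = []")
    case True
    then show ?thesis using snoc.prems p by simp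
  next
    case False
    have IH: "fold row_insert (concat (map (\<lambda>(m, a). [m, a]) ps)) [] = [map snd ps, map fst ps]"
      using snoc False by (auto simp: sorted_wrt_append)
    have m: "\<forall>x \<in> set (map fst ps). x < m" and a: "\<forall>x \<in> set (map snd ps). x < a" and "a < m"
      using snoc.prems p by (auto simp: sorted_wrt_append)
    then have "\<forall>x \<in> set (map snd ps). x \<le> m" by force
    then have "row_bump m (map snd ps) = (map snd ps @ [m], None)"
      by (simp add: row_bump_None)
    moreover have "row_bump a (map snd ps @ [m]) = (map snd ps @ [a], Some m)"
      using row_bump_append[OF a, of "[m]"] \<open>a < m\<close> by simp
    moreover have "row_bump m (map fst ps) = (map fst ps @ [m], None)"
      using m by (auto simp: row_bump_None less_imp_le)
    ultimately show ?thesis using IH p by simp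
  qed
qed simp

lemma LR_blocks:
  assumes "\<pi> permutes {1..n}" "block_form bs" "one_line n \<pi> = block_word bs"
  shows "LR n \<pi> = fst ` set bs"
proof -
  have disj: "fst ` set bs \<inter> set (concat (map snd bs)) = {}"
    using distinct_block_word_disjoint one_line_permutes(1)[OF assms(1)] assms(3) by simp
  show ?thesis
    unfolding LR_one_line assms(3)
  proof (intro equalityI subsetI)
    fix a assume "a \<in> {a. \<exists>p q. block_word bs = p @ a # q \<and> (\<forall>y \<in> set p. y < a)}"
    then obtain p q where "block_word bs = p @ a # q" "\<forall>y \<in> set p. y < a" by blast
    then show "a \<in> fst ` set bs" using block_word_split[OF assms(2), of p a q] by (auto dest: less_asym)
  next
    fix a assume a: "a \<in> fst ` set bs"
    then have "a \<in> set (block_word bs)" by (simp add: set_block_word)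
    then obtain p q where "block_word bs = p @ a # q" using split_list by metis
    then show "a \<in> {a. \<exists>p q. block_word bs = p @ a # q \<and> (\<forall>y \<in> set p. y < a)}"
      using block_word_split[OF assms(2), of p a q] a disj by blast
  qed
qed

lemma sorted_list_of_set_strict: "sorted_wrt (<) xs \<Longrightarrow> sorted_list_of_set (set xs) = xs" for xs :: "nat list"
  by (simp add: strict_sorted_iff sorted_list_of_set.idem_if_sorted_distinct)

lemma lr_max_blocks:
  assumes "\<pi> permutes {1..n}" "block_form bs" "one_line n \<pi> = block_word bs"
  shows "card (LR n \<pi>) = length bs"
    and "j < length bs \<Longrightarrow> lr_max n \<pi> (Suc j) = fst (bs ! j)"
proof -
  have LR: "LR n \<pi> = set (map fst bs)" using LR_blocks[OF assms] by simp
  show "card (LR n \<pi>) = length bs"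
    unfolding LR using distinct_card[of "map fst bs"] sorted_maxima[OF assms(2)] by (simp add: strict_sorted_iff)
  show "j < length bs \<Longrightarrow> lr_max n \<pi> (Suc j) = fst (bs ! j)"
    unfolding lr_max_def LR sorted_list_of_set_strict[OF sorted_maxima[OF assms(2)]] by simp
qed

lemma sorted_block: "block_form bs \<Longrightarrow> (m, xs) \<in> set bs \<Longrightarrow> sorted_wrt (<) xs"
proof (induction bs)
  case (Cons b bs)
  then show ?case by (cases b) auto
qed simp

text \<open>
  The positions strictly between two successive maxima are those of the block of the first one, whose
  maximum is its last entry because it is increasing; the last block ends with $\pi_n$.
\<close>

lemma a_entry_blocks:
  assumes "\<pi> permutes {1..n}" "block_form bs" "one_line n \<pi> = block_word bs" and "j < length bs"
  shows "a_entry n \<pi> (Suc j) = last (snd (bs ! j))"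
proof (cases "Suc j < length bs")
  case True
  define W where "W = block_word (take j bs)"
  obtain m xs where b: "bs ! j = (m, xs)" by fastforce
  obtain l ys where c: "bs ! Suc j = (l, ys)" by fastforce
  define V where "V = ys @ block_word (drop (Suc (Suc j)) bs)"
  have "bs = take j bs @ bs ! j # bs ! Suc j # drop (Suc (Suc j)) bs"
    using True by (metis Cons_nth_drop_Suc Suc_lessD append_take_drop_id)
  then have "block_word bs = block_word (take j bs @ bs ! j # bs ! Suc j # drop (Suc (Suc j)) bs)"
    by simp
  then have eq: "one_line n \<pi> = W @ m # (xs @ l # V)"
    unfolding assms(3) by (simp add: b c W_def V_def)
  then obtain i where i: "i \<in> {1..n}" "W = map \<pi> [1..<i]" "m = \<pi> i"
    unfolding one_line_eq_split_iff by blast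
  from eq have "one_line n \<pi> = (W @ m # xs) @ l # V" by simp
  then obtain k where k: "k \<in> {1..n}" "W @ m # xs = map \<pi> [1..<k]" "l = \<pi> k"
    unfolding one_line_eq_split_iff by blast
  have "length W = i - 1" by (simp add: i(2))
  moreover have "length (W @ m # xs) = k - 1" by (simp only: k(2) length_map length_upt)
  ultimately have "i < k" by auto
  then have "[1..<k] = [1..<i] @ i # [Suc i..<k]"
    using i(1) by (intro upt_split) auto
  then have "xs = map \<pi> [Suc i..<k]"
    using k(2) i by simp
  then have "set xs = \<pi> ` {i<..<k}" by (auto simp: atLeastSucLessThan_greaterThanLessThan)
  moreover have "inv \<pi> m = i" "inv \<pi> l = k"
    using i(3) k(3) permutes_inverses(2)[OF assms(1)] by auto
  moreover have "Max (set xs) = last xs"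
  proof (rule Max_eqI)
    have "(m, xs) \<in> set bs" using b assms(4) by (metis nth_mem)
    then show "y \<in> set xs \<Longrightarrow> y \<le> last xs" "last xs \<in> set xs" for y
      using sorted_le_last[OF sorted_block[OF assms(2)]] blocks_nonempty[OF assms(2)] by auto
  qed simp
  ultimately show ?thesis
    using True lr_max_blocks[OF assms(1-3)] by (simp add: a_entry_def b c)
next
  case False
  then have "bs = butlast bs @ [bs ! j]"
    using assms(4) by (metis Suc_lessI append_butlast_last_id diff_Suc_1 last_conv_nth length_0_conv not_less_zero)
  moreover obtain m xs where b: "bs ! j = (m, xs)" by fastforce
  ultimately have "block_word bs = block_word (butlast bs) @ m # xs"
    by (metis append_Nil2 block_word_simps)
  moreover have "xs \<noteq> []" using blocks_nonempty[OF assms(2)] b assms(4) by (metis nth_mem)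
  ultimately have "last (one_line n \<pi>) = last xs" and "one_line n \<pi> \<noteq> []"
    unfolding assms(3) by auto
  moreover from this(2) have "last (one_line n \<pi>) = \<pi> n" by (auto split: if_splits)
  ultimately show ?thesis
    using False lr_max_blocks(1)[OF assms(1-3)] by (simp add: a_entry_def b)
qed

lemma A_set_blocks:
  assumes "\<pi> permutes {1..n}" "block_form bs" "one_line n \<pi> = block_word bs"
  shows "A_set n \<pi> = (last \<circ> snd) ` set bs"
proof -
  have "A_set n \<pi> = a_entry n \<pi> ` Suc ` {..<length bs}"
    unfolding A_set_def lr_max_blocks(1)[OF assms] by (simp add: image_Suc_lessThan)
  also have "\<dots> = (\<lambda>j. last (snd (bs ! j))) ` {..<length bs}"
    unfolding image_image using a_entry_blocks[OF assms] by (intro image_cong) auto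
  also have "\<dots> = (last \<circ> snd) ` set bs"
    by (force simp: set_conv_nth image_iff)
  finally show ?thesis .
qed

lemma theta_blocks:
  assumes "\<pi> permutes {1..n}" "block_form bs" "one_line n \<pi> = block_word bs"
  shows "theta n \<pi> = concat (map (\<lambda>(m, a). [m, a]) (map (\<lambda>(m, xs). (m, last xs)) bs)) @
     sorted_list_of_set ({1..n} - (A_set n \<pi> \<union> LR n \<pi>))"
proof -
  have "map (\<lambda>j. [lr_max n \<pi> j, a_entry n \<pi> j]) [1..<length bs + 1]
      = map (\<lambda>(m, a). [m, a]) (map (\<lambda>(m, xs). (m, last xs)) bs)"
    using lr_max_blocks(2)[OF assms] a_entry_blocks[OF assms]
    by (intro nth_equalityI) (auto simp: case_prod_unfold simp del: upt_Suc)
  then show ?thesis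
    unfolding theta_def lr_max_blocks(1)[OF assms] by simp
qed

definition step_word :: "nat \<Rightarrow> (nat \<Rightarrow> nat) \<Rightarrow> step list" where
  "step_word n \<pi> =
     map (\<lambda>k. if k \<in> LR n \<pi> then Down else if k \<in> A_set n \<pi> then Up else Level) (rev [1..<Suc n])"

lemma positions_step_word:
  assumes "\<pi> permutes {1..n}" "block_form bs" "one_line n \<pi> = block_word bs"
  shows "positions Down (step_word n \<pi>) = map fst bs"
    and "positions Up (step_word n \<pi>) = map (last \<circ> snd) bs"
    and "positions Level (step_word n \<pi>) = sorted_list_of_set ({1..n} - (A_set n \<pi> \<union> LR n \<pi>))"
proof -
  have range: "fst ` set bs \<union> set (concat (map snd bs)) = {1..n}"
    using one_line_permutes(2)[OF assms(1)] unfolding assms(3) set_block_word .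
  have disj: "fst ` set bs \<inter> set (concat (map snd bs)) = {}"
    using distinct_block_word_disjoint one_line_permutes(1)[OF assms(1)] assms(3) by simp
  have lasts: "last (snd b) \<in> set (concat (map snd bs))" if "b \<in> set bs" for b
    using blocks_nonempty[OF assms(2), of "fst b" "snd b"] that by (auto intro!: bexI[of _ b])
  have eq: "positions x (step_word n \<pi>) = ys"
    if "sorted_wrt (<) ys" "{k \<in> {1..n}. (if k \<in> LR n \<pi> then Down else if k \<in> A_set n \<pi> then Up else Level) = x} = set ys"
    for x ys
    unfolding step_word_def positions_map_rev_upt
  proof (rule strict_sorted_equal[OF that(1) sorted_wrt_filter[OF sorted_wrt_upt]])
    show "set (filter (\<lambda>k. (if k \<in> LR n \<pi> then Down else if k \<in> A_set n \<pi> then Up else Level) = x)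
        [1..<Suc n]) = set ys"
      unfolding that(2)[symmetric] by auto
  qed
  note LR = LR_blocks[OF assms] and A = A_set_blocks[OF assms]
  have LR_sub: "LR n \<pi> \<subseteq> {1..n}" using range unfolding LR by blast
  have A_sub: "A_set n \<pi> \<subseteq> {1..n}" "A_set n \<pi> \<inter> LR n \<pi> = {}"
  proof -
    have "A_set n \<pi> \<subseteq> set (concat (map snd bs))" using lasts unfolding A by (auto simp del: set_concat)
    then show "A_set n \<pi> \<subseteq> {1..n}" "A_set n \<pi> \<inter> LR n \<pi> = {}"
      using range disj unfolding LR by blast+
  qed
  show "positions Down (step_word n \<pi>) = map fst bs"
    by (rule eq[OF sorted_maxima[OF assms(2)]]) (use LR_sub LR in auto)
  show "positions Up (step_word n \<pi>) = map (last \<circ> snd) bs"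
  proof (rule eq[OF sorted_lasts[OF assms(2)]])
    have "set (map (last \<circ> snd) bs) = A_set n \<pi>" by (simp add: A)
    then show "{k \<in> {1..n}. (if k \<in> LR n \<pi> then Down else if k \<in> A_set n \<pi> then Up else Level) = Up}
        = set (map (last \<circ> snd) bs)"
      using A_sub by auto
  qed
  show "positions Level (step_word n \<pi>) = sorted_list_of_set ({1..n} - (A_set n \<pi> \<union> LR n \<pi>))"
    by (rule eq) auto
qed

text \<open>
  A path that never goes below height zero and returns to it, without level steps after its last up step
  (which comes first in the backward word).
\<close>

definition good_steps :: "step list \<Rightarrow> bool" where
  "good_steps u \<longleftrightarrow> ballot Up Down u \<and> count_list u Up = count_list u Down \<and>
     Level \<notin> set (takeWhile (\<lambda>x. x \<noteq> Up) u)"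

lemma Level_before_Up_iff:
  "Level \<notin> set (takeWhile (\<lambda>x. x \<noteq> Up) u) \<longleftrightarrow>
     (\<forall>b \<in> set (positions Level u). \<exists>a \<in> set (positions Up u). b < a)"
proof (induction u)
  case (Cons x u)
  show ?case
  proof (cases x)
    case Up
    then show ?thesis using positions_less[of Level u] by auto
  next
    case Down
    then show ?thesis using Cons by simp
  next
    case Level
    then show ?thesis using positions_less[of Up u] by fastforce
  qed
qed simp

text \<open>
  The inequality between the last entry of a block and its maximum is the ballot condition, and every
  \<open>Level\<close> value lies below the last entry of its own block, which is an \<open>Up\<close> value.
\<close>

lemma good_step_word:
  assumes "\<pi> \<in> frakR n"
  shows "good_steps (step_word n \<pi>)"
proof -
  obtain bs where bs: "block_form bs" "one_line n \<pi> = block_word bs"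
    using frakR_block_form[OF assms] by blast
  have perm: "\<pi> permutes {1..n}" using assms by (simp add: frakR_def)
  note pos = positions_step_word[OF perm bs]
  have counts: "count_list (step_word n \<pi>) Down = length bs" "count_list (step_word n \<pi>) Up = length bs"
    unfolding length_positions[symmetric] pos by simp_all
  have "last (snd (bs ! i)) < fst (bs ! i)" if "i < length bs" for i
    using blocks_nonempty[OF bs(1), of "fst (bs ! i)" "snd (bs ! i)"] that by simp
  then have "ballot Up Down (step_word n \<pi>)"
    unfolding ballot_iff_positions[of Up Down, simplified] counts pos by simp
  moreover have "\<exists>a \<in> set (positions Up (step_word n \<pi>)). b < a"
    if b: "b \<in> set (positions Level (step_word n \<pi>))" for b
  proof -
    from b have b: "b \<in> {1..n}" "b \<notin> A_set n \<pi>" "b \<notin> LR n \<pi>" unfolding pos by auto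
    then have "b \<in> set (block_word bs)" using one_line_permutes(2)[OF perm] bs(2) by metis
    then obtain m xs where c: "(m, xs) \<in> set bs" "b \<in> set xs"
      using b(3) LR_blocks[OF perm bs] unfolding set_block_word by auto
    have "last xs \<in> A_set n \<pi>" using c A_set_blocks[OF perm bs] by force
    then have "b < last xs"
      using b(2) sorted_le_last[OF sorted_block[OF bs(1) c(1)] c(2)] by (metis le_neq_implies_less)
    then show ?thesis using c(1) unfolding pos by force
  qed
  ultimately show ?thesis
    using counts unfolding good_steps_def Level_before_Up_iff by simp
qed

lemma length_step_word [simp]: "length (step_word n \<pi>) = n"
  by (simp add: step_word_def)

text \<open>
  Since the concatenation is increasing, the first block is cut off from it by the bound given by its
  last entry.
\<close>

lemma blocks_inject:
  assumes "block_form bs" "block_form cs" "map fst bs = map fst cs"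
    "map (last \<circ> snd) bs = map (last \<circ> snd) cs" "concat (map snd bs) = concat (map snd cs)"
  shows "bs = cs"
  using assms
proof (induction bs arbitrary: cs)
  case (Cons b bs)
  then obtain c cs' where cs: "cs = c # cs'" by (cases cs) auto
  obtain m xs where b: "b = (m, xs)" by fastforce
  obtain ys where c: "c = (m, ys)" using Cons.prems(3) cs b by (cases c) auto
  have last: "last xs = last ys" using Cons.prems(4) cs b c by simp
  have filter: "filter (\<lambda>y. y \<le> last xs) (concat (map snd (b # bs))) = xs"
    if "block_form (b # bs)" "b = (m, xs)" for b m xs and bs :: blocks
  proof -
    have "last xs \<in> set xs" using that by simp
    then have "\<forall>y \<in> set (concat (map snd bs)). \<not> y \<le> last xs"
      using that unfolding that(2) block_form_Cons not_le by blast
    then have "filter (\<lambda>y. y \<le> last xs) (concat (map snd bs)) = []"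
      unfolding filter_empty_conv .
    moreover have "filter (\<lambda>y. y \<le> last xs) xs = xs"
      using that sorted_le_last[of xs] by (intro filter_True) auto
    ultimately show ?thesis using that by simp
  qed
  have "xs = ys"
    using filter[OF Cons.prems(1) b] filter[OF Cons.prems(2)[unfolded cs] c] Cons.prems(5) last cs
    by metis
  then show ?case using Cons b c cs by simp
qed simp

lemma step_word_inject:
  assumes "\<pi> \<in> frakR n" "\<sigma> \<in> frakR n" "step_word n \<pi> = step_word n \<sigma>"
  shows "\<pi> = \<sigma>"
proof -
  obtain bs where bs: "block_form bs" "one_line n \<pi> = block_word bs"
    using frakR_block_form[OF assms(1)] by blast
  obtain cs where cs: "block_form cs" "one_line n \<sigma> = block_word cs"
    using frakR_block_form[OF assms(2)] by blast
  have perm: "\<pi> permutes {1..n}" "\<sigma> permutes {1..n}" using assms by (simp_all add: frakR_def)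
  have maxima: "map fst bs = map fst cs"
    using positions_step_word(1)[OF perm(1) bs] positions_step_word(1)[OF perm(2) cs] assms(3) by simp
  have lasts: "map (last \<circ> snd) bs = map (last \<circ> snd) cs"
    using positions_step_word(2)[OF perm(1) bs] positions_step_word(2)[OF perm(2) cs] assms(3) by simp
  have rest: "set (concat (map snd ds)) = {1..n} - set (map fst ds)"
    if "\<tau> permutes {1..n}" "one_line n \<tau> = block_word ds" for ds \<tau>
  proof -
    have "distinct (block_word ds)" "set (block_word ds) = {1..n}"
      using one_line_permutes[OF that(1)] unfolding that(2) .
    then show ?thesis using distinct_block_word_disjoint[of ds] set_block_word[of ds] by auto
  qed
  have "set (concat (map snd bs)) = set (concat (map snd cs))"
    using rest[OF perm(1) bs(2)] rest[OF perm(2) cs(2)] maxima by simp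
  then have "concat (map snd bs) = concat (map snd cs)"
    using bs(1) cs(1) strict_sorted_equal unfolding block_form_def by blast
  then have "bs = cs" using blocks_inject[OF bs(1) cs(1) maxima lasts] by simp
  then show ?thesis using one_line_inject[OF perm] bs(2) cs(2) by metis
qed

text \<open>
  Conversely, cutting an increasing list after each of the entries \<open>as\<close> produces the blocks; the last
  condition on \<open>xs\<close> ensures that nothing is left over at the end.
\<close>

lemma exists_blocks:
  assumes "length ms = length as" "sorted_wrt (<) ms" "sorted_wrt (<) as" "sorted_wrt (<) xs"
    "set as \<subseteq> set xs" "\<forall>x \<in> set xs. \<exists>a \<in> set as. x \<le> a" "\<forall>i < length as. as ! i < ms ! i"
  shows "\<exists>bs. block_form bs \<and> map fst bs = ms \<and> map (last \<circ> snd) bs = as \<and> concat (map snd bs) = xs"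
  using assms
proof (induction ms as arbitrary: xs rule: list_induct2')
  case 1
  then show ?case by (intro exI[of _ "[]"]) auto
next
  case (4 m ms a as)
  define ys where "ys = filter (\<lambda>x. x \<le> a) xs"
  define zs where "zs = filter (\<lambda>x. \<not> x \<le> a) xs"
  have sorted: "sorted_wrt (<) ys" "sorted_wrt (<) zs"
    using 4(5) by (simp_all add: ys_def zs_def sorted_wrt_filter)
  have xs: "xs = ys @ zs"
  proof (rule strict_sorted_equal)
    show "sorted_wrt (<) (ys @ zs)"
      using sorted by (auto simp: sorted_wrt_append ys_def zs_def)
  qed (use 4(5) in \<open>auto simp: ys_def zs_def\<close>)
  have "a \<in> set ys" using 4(6) by (simp add: ys_def)
  then have "ys \<noteq> []" by auto
  have last: "last ys = a"
  proof (rule antisym)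
    have "last ys \<in> set ys" using \<open>a \<in> set ys\<close> by (cases ys) auto
    then show "last ys \<le> a" by (simp add: ys_def)
    show "a \<le> last ys" using sorted_le_last[OF sorted(1) \<open>a \<in> set ys\<close>] .
  qed
  have above: "\<forall>x \<in> set as. a < x" using 4(4) by simp
  have "\<exists>bs. block_form bs \<and> map fst bs = ms \<and> map (last \<circ> snd) bs = as \<and> concat (map snd bs) = zs"
  proof (rule 4(1)[OF _ _ _ sorted(2)])
    show "\<forall>x \<in> set zs. \<exists>a \<in> set as. x \<le> a" using 4(7) by (auto simp: zs_def)
    show "set as \<subseteq> set zs" using 4(6) above by (auto simp: zs_def)
    show "\<forall>i < length as. as ! i < ms ! i" using 4(8) by fastforce
  qed (use 4 in auto)
  then obtain bs where bs: "block_form bs" "map fst bs = ms" "map (last \<circ> snd) bs = as"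
    "concat (map snd bs) = zs" by blast
  have "a < m" using 4(8) by fastforce
  have "fst ` set bs = set ms" using bs(2) by (metis set_map)
  then have "block_form ((m, ys) # bs)"
    using bs(1) \<open>ys \<noteq> []\<close> last sorted(1) 4(3) \<open>a < m\<close>
    unfolding block_form_Cons bs(4) by (simp, auto simp: ys_def zs_def)
  then show ?case
    using bs last xs by (intro exI[of _ "(m, ys) # bs"]) (simp add: o_def)
qed auto

lemma step_word_surj:
  assumes "good_steps u"
  shows "\<exists>\<pi> \<in> frakR (length u). step_word (length u) \<pi> = u"
proof -
  define n where "n = length u"
  define D where "D = set (positions Down u)"
  define xs where "xs = sorted_list_of_set ({1..n} - D)"
  have D: "D \<subseteq> {1..n}" by (auto simp: D_def n_def dest: positions_le)
  have set_xs: "set xs = {1..n} - D" by (simp add: xs_def)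
  have up: "set (positions Up u) \<subseteq> set xs"
    using positions_disjoint[of Up Down u] positions_le[of _ Up u]
    unfolding set_xs D_def n_def by auto
  have level: "set (positions Level u) = {1..n} - (D \<union> set (positions Up u))"
    unfolding D_def set_positions n_def by (auto, metis step.exhaust)
  have "\<exists>bs. block_form bs \<and> map fst bs = positions Down u \<and>
      map (last \<circ> snd) bs = positions Up u \<and> concat (map snd bs) = xs"
  proof (rule exists_blocks)
    show "\<forall>x \<in> set xs. \<exists>a \<in> set (positions Up u). x \<le> a"
    proof
      fix x assume "x \<in> set xs"
      then have "x \<in> set (positions Up u) \<or> x \<in> set (positions Level u)"
        unfolding set_xs level by blast
      then show "\<exists>a \<in> set (positions Up u). x \<le> a"
        using assms unfolding good_steps_def Level_before_Up_iff by (metis less_imp_le order_refl)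
    qed
    show "\<forall>i < length (positions Up u). positions Up u ! i < positions Down u ! i"
      using assms ballot_iff_positions[of Up Down u] by (simp add: good_steps_def)
  qed (use assms up in \<open>auto simp: good_steps_def sorted_positions xs_def\<close>)
  then obtain bs where bs: "block_form bs" "map fst bs = positions Down u"
      "map (last \<circ> snd) bs = positions Up u" "concat (map snd bs) = xs" by blast
  have "fst ` set bs = D" using bs(2) by (metis D_def set_map)
  then have set_bs: "set (block_word bs) = {1..n}"
    unfolding set_block_word bs(4) set_xs using D by blast
  have "length (block_word bs) = card D + card ({1..n} - D)"
    unfolding length_block_word bs(4)
    using arg_cong[OF bs(2), of length] distinct_card[OF distinct_positions[of Down u]]
    by (simp add: xs_def D_def)
  also have "\<dots> = n" using D by (simp add: card_Diff_subset finite_subset[OF D] card_mono[OF _ D, simplified])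
  finally have "distinct (block_word bs)"
    using set_bs by (simp add: card_distinct)
  then obtain \<pi> where \<pi>: "\<pi> permutes {1..n}" "one_line n \<pi> = block_word bs"
    using exists_one_line set_bs by blast
  have "\<pi> \<in> frakR n" using block_word_frakR[OF \<pi>(1) bs(1) \<pi>(2)] .
  moreover have "step_word n \<pi> = u"
  proof (rule positions_inject)
    note pos = positions_step_word[OF \<pi>(1) bs(1) \<pi>(2)]
    have A: "A_set n \<pi> = set (positions Up u)" using A_set_blocks[OF \<pi>(1) bs(1) \<pi>(2)] bs(3) by (metis set_map)
    have L: "LR n \<pi> = D" using LR_blocks[OF \<pi>(1) bs(1) \<pi>(2)] \<open>fst ` set bs = D\<close> by simp
    show "set (positions x (step_word n \<pi>)) = set (positions x u)" for x
    proof (cases x)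
      case Level
      then show ?thesis using pos(3) level A L by (simp add: Un_commute)
    qed (simp_all only: pos bs)
  qed (simp add: n_def)
  ultimately show ?thesis unfolding n_def by blast
qed

section \<open>Bijectivity of the map\<close>

lemma run_reachable:
  assumes "run u v p 0" and "good_steps u"
  shows "reachable v" and "count_list v R1 = count_list v R2 + p"
proof -
  have ballot: "ballot Up Down u" and bal: "count_list u Up = count_list u Down"
    using assms(2) by (auto simp: good_steps_def)
  show count: "count_list v R1 = count_list v R2 + p"
    using run_counts(1)[OF assms(1)] bal by simp
  show "reachable v"
    using run_ballot_out[OF assms(1) ballot] run_last_Up[OF assms(1)] assms(2) count
    by (auto simp: reachable_def yamanouchi_def good_steps_def)
qed

lemma run_ends_empty:
  assumes "run u v p q" and "good_steps u"
  shows "q = 0"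
  using run_ballot_out[OF assms(1)] assms(2) by (simp add: good_steps_def)

lemma reachable_run:
  assumes "reachable v" and "count_list v R1 = count_list v R2 + p"
  shows "\<exists>u. run u v p 0 \<and> good_steps u"
proof -
  have yam: "ballot R1 R2 v" "ballot R2 R3 v" using assms(1) by (auto simp: reachable_def yamanouchi_def)
  obtain u where run: "run u v p 0"
    using run_exists_backward[OF yam, of p 0] assms(2) ballot_count[OF yam(2)] by auto
  have "count_list u Up = count_list u Down"
    using run_counts[OF run] assms(2) by simp
  moreover have "ballot Up Down u"
    using run_ballot_in[OF run yam(1)] assms(2) by simp
  moreover have "Level \<notin> set (takeWhile (\<lambda>x. x \<noteq> Up) u)"
    using run_last_Up[OF run] assms by (auto simp: reachable_def)
  ultimately show ?thesis using run by (auto simp: good_steps_def)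
qed

lemma P_tableau_theta:
  assumes "\<pi> \<in> frakR n" and "run (step_word n \<pi>) v p 0"
  shows "P_tableau (theta n \<pi>) = tableau_of v"
proof -
  define u where "u = step_word n \<pi>"
  have run: "run u v p 0" using assms(2) u_def by simp
  obtain bs where bs: "block_form bs" "one_line n \<pi> = block_word bs"
    using frakR_block_form[OF assms(1)] by blast
  have perm: "\<pi> permutes {1..n}" using assms by (simp add: frakR_def)
  note pos = positions_step_word[OF perm bs, folded u_def]
  define ps where "ps = map (\<lambda>(m, xs). (m, last xs)) bs"
  have ps: "map fst ps = positions Down u" "map snd ps = positions Up u"
    by (auto simp: ps_def pos)
  have theta: "theta n \<pi> = concat (map (\<lambda>(m, a). [m, a]) ps) @ positions Level u"
    unfolding theta_blocks[OF perm bs] pos ps_def ..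
  show ?thesis
  proof (cases "bs = []")
    case True
    then have "n = 0" using bs(2) by (auto split: if_splits)
    then have "u = []" by (simp add: u_def step_word_def)
    then have "v = []" using run_length[OF run] by simp
    then show ?thesis using theta \<open>u = []\<close> True
      by (simp add: ps_def P_tableau_def tableau_of_def of_rows_def strip_while_def)
  next
    case False
    obtain c where c: "bump_all (positions Up u) (positions Level u) = (positions R1 v, c)"
      "bump_all (positions Down u) c = (positions R2 v, positions R3 v)"
      using run_bump_all[OF run] by blast
    have "fold row_insert (concat (map (\<lambda>(m, a). [m, a]) ps)) [] = [map snd ps, map fst ps]"
    proof (rule fold_row_insert_pairs)
      show "\<forall>(m, a) \<in> set ps. a < m"
        using blocks_nonempty[OF bs(1)] by (auto simp: ps_def)
    qed (use False in \<open>auto simp: ps sorted_positions ps_def[symmetric], simp add: ps_def\<close>)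
    then have "P_tableau (theta n \<pi>) =
        fold row_insert (positions Level u) [positions Up u, positions Down u]"
      by (simp add: P_tableau_def theta ps)
    also have "\<dots> = positions R1 v # positions R2 v # fold row_insert (positions R3 v) []"
      by (simp add: fold_row_insert_Cons[OF c(1)] fold_row_insert_Cons[OF c(2)])
    also have "fold row_insert (positions R3 v) [] = (if positions R3 v = [] then [] else [positions R3 v])"
    proof (cases "positions R3 v")
      case (Cons y ys)
      have "bump_all [y] ys = ([y] @ ys, [])"
        by (rule bump_all_increasing_above)
          (use sorted_positions[of R3 v] Cons in \<open>auto simp: less_imp_le\<close>)
      then show ?thesis using Cons fold_row_insert_Cons by simp
    qed simp
    also have "positions R1 v # positions R2 v # \<dots> = tableau_of v"
    proof -
      have "good_steps u" using good_step_word[OF assms(1)] u_def by simp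
      then have "reachable v" using run_reachable[OF run] by simp
      then have "count_list v R2 \<le> count_list v R1"
        by (auto simp: reachable_def yamanouchi_def dest: ballot_count)
      moreover have "count_list v R2 = length bs"
        using run_counts(2)[OF run] arg_cong[OF pos(1), of length] by simp
      ultimately have "positions R1 v \<noteq> []" "positions R2 v \<noteq> []"
        using False by (auto simp: positions_eq_Nil simp flip: length_greater_0_conv)
      then show ?thesis
        by (simp add: tableau_of_def of_rows_def strip_while_def)
    qed
    finally show ?thesis .
  qed
qed

text \<open>
  The case distinction in the definition of $\Phi$ is harmless, because a tableau with row lengths of equal
  parity has no defective row and is fixed by $\Psi$.
\<close>

lemma Phi_factors:
  assumes "\<pi> \<in> frakR n"
  shows "\<exists>v p s. run (step_word n \<pi>) v p 0 \<and> corrects v s \<and> Phi n \<pi> = tableau_of s"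
proof -
  note good = good_step_word[OF assms]
  obtain v p where run: "run (step_word n \<pi>) v p 0"
    using run_exists_forward run_ends_empty[OF _ good] by metis
  have reach: "reachable v" using run_reachable(1)[OF run good] .
  obtain s where s: "corrects v s" using corrects_exists[OF reach] by blast
  have "Phi n \<pi> = (if equal_parity (tableau_of v) then tableau_of v else Psi (tableau_of v))"
    by (simp add: Phi_def P_tableau_theta[OF assms run])
  also have "\<dots> = Psi (tableau_of v)"
    by (auto simp: equal_parity_tableau_of Psi_def defective_tableau_of)
  also have "\<dots> = tableau_of s" using Psi_tableau_of[OF s reach] .
  finally show ?thesis using run s by blast
qed

theorem theorem3p3:
  fixes n :: nat
  shows "bij_betw (Phi n) (frakR n) (SYT_le3_eqpar n)"
  unfolding bij_betw_def
proof
  show "inj_on (Phi n) (frakR n)"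
  proof (rule inj_onI)
    fix \<pi> \<sigma>
    assume \<pi>: "\<pi> \<in> frakR n" and \<sigma>: "\<sigma> \<in> frakR n" and eq: "Phi n \<pi> = Phi n \<sigma>"
    obtain v p s where v: "run (step_word n \<pi>) v p 0" "corrects v s" "Phi n \<pi> = tableau_of s"
      using Phi_factors[OF \<pi>] by blast
    obtain v' p' s' where v': "run (step_word n \<sigma>) v' p' 0" "corrects v' s'" "Phi n \<sigma> = tableau_of s'"
      using Phi_factors[OF \<sigma>] by blast
    note reach = run_reachable[OF v(1) good_step_word[OF \<pi>]]
    note reach' = run_reachable[OF v'(1) good_step_word[OF \<sigma>]]
    have "length s = length s'"
      using corrects_length[OF v(2)] corrects_length[OF v'(2)] run_length[OF v(1)] run_length[OF v'(1)]
      by simp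
    then have "s = s'" using tableau_of_inject[of s s'] v(3) v'(3) eq by simp
    then have "v = v'" using corrects_inject[OF v(2) _ reach(1) reach'(1)] v'(2) by simp
    then have "step_word n \<pi> = step_word n \<sigma>"
      using run_reversible[OF v(1)] v'(1) reach(2) reach'(2) by simp
    then show "\<pi> = \<sigma>" using step_word_inject[OF \<pi> \<sigma>] by simp
  qed
  show "Phi n ` frakR n = SYT_le3_eqpar n"
  proof (intro equalityI subsetI)
    fix T assume "T \<in> Phi n ` frakR n"
    then obtain \<pi> where \<pi>: "\<pi> \<in> frakR n" "T = Phi n \<pi>" by blast
    obtain v p s where v: "run (step_word n \<pi>) v p 0" "corrects v s" "T = tableau_of s"
      using Phi_factors[OF \<pi>(1)] \<pi>(2) by blast
    have "reachable v" using run_reachable(1)[OF v(1) good_step_word[OF \<pi>(1)]] .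
    moreover have "length s = n" using corrects_length[OF v(2)] run_length[OF v(1)] by simp
    ultimately show "T \<in> SYT_le3_eqpar n"
      using tableau_of_in_SYT[OF corrects_yamanouchi[OF v(2)]] corrects_even[OF v(2)] v(3)
      by (auto simp: SYT_le3_eqpar_def equal_parity_tableau_of)
  next
    fix T assume T: "T \<in> SYT_le3_eqpar n"
    then obtain s where s: "yamanouchi s" "length s = n" "tableau_of s = T"
      using tableau_of_surj unfolding SYT_le3_eqpar_def by blast
    then obtain v where v: "reachable v" "corrects v s"
      using corrects_surj[OF s(1)] T equal_parity_tableau_of[of s] by (auto simp: SYT_le3_eqpar_def)
    have "count_list v R2 \<le> count_list v R1"
      using v(1) by (auto simp: reachable_def yamanouchi_def dest: ballot_count)
    then obtain u where u: "run u v (count_list v R1 - count_list v R2) 0" "good_steps u"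
      using reachable_run[OF v(1)] le_add_diff_inverse by metis
    have "length u = n" using run_length[OF u(1)] corrects_length[OF v(2)] s(2) by simp
    then obtain \<pi> where \<pi>: "\<pi> \<in> frakR n" "step_word n \<pi> = u"
      using step_word_surj[OF u(2)] by blast
    obtain v' p' s' where v': "run u v' p' 0" "corrects v' s'" "Phi n \<pi> = tableau_of s'"
      using Phi_factors[OF \<pi>(1)] \<pi>(2) by blast
    have "v' = v" using run_deterministic[OF v'(1) u(1)] by simp
    then have "Phi n \<pi> = T"
      using v' v Psi_tableau_of s(3) by metis
    then show "T \<in> Phi n ` frakR n" using \<pi>(1) by blast
  qed
qed

end
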